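(* The following relations hold: \[ \sup_{a\in\mathbb{R}}(A^+_a\wedge A^-_a) \leq c_P\leq \inf_{a\in\mathbb{R}}(A^+_a\vee A^-_a). \] Moreover, $c_P<\infty$ if and only if the constants $A^+_a$, $A^-_a$ (or equivalently $B^+_a$, $B^-_a$) are all finite for some $a\in\mathbb{R}$.
   Context: $S:\mathbb{R}\to\mathbb{R}$ is a strictly increasing continuous function with $\lim_{x\to\pm\infty}S(x)=\pm\infty$, and $m$ is a positive Borel measure on $\mathbb{R}$ with $0<m(\mathbb{R})<\infty$ (they need not come from a process). $dS$ denotes the Stieltjes measure induced by $S$. For a real function $F$ on $\mathbb{R}$ write $dF\ll dS$ if there is a locally $dS$-integrable function $f$ with $\int_u^v f\,dS=F(v)-F(u)$ for all $u<v$; then $f$ is denoted $\frac{dF}{dS}$. Let \[ \mathcal{F}=\left\{F\in L^2(m):\ dF\ll dS,\ \frac{dF}{dS}\in L^2(dS)\right\}. \] For $a\in\mathbb{R}$, $A_a^+\in[0,\infty]$ is the infimum of the constants $A\in[0,\infty]$ such that $\int_{a}^\infty (F(x)-F(a))^2\,dm(x)\leq A\int_a^{\infty} \left(\frac{dF}{dS}\right)^2 dS$ for all $F\in\mathcal{F}$, and $A_a^-\in[0,\infty]$ is the infimum of the constants $A\in[0,\infty]$ such that $\int_{-\infty}^a (F(x)-F(a))^2\,dm(x)\leq A\int_{-\infty}^{a} \left(\frac{dF}{dS}\right)^2 dS$ for all $F\in\mathcal{F}$ ($A=\infty$ is always admissible). $B^+_a=\sup_{x\geq a} m(]x,+\infty[)(S(x)-S(a))$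 and $B^-_a=\sup_{x\leq a} m(]-\infty,x[)(S(a)-S(x))$. $c_P\in[0,\infty]$ is the infimum of the constants $c\in[0,\infty]$ for which the Poincaré inequality \[ \int_{-\infty}^{+\infty}\left(F(x)-\overline{m}(F)\right)^2 dm(x)\leq c\int_{-\infty}^{+\infty}\left(\frac {dF}{dS}\right)^2 dS\quad\text{for all }F\in\mathcal{F} \] holds, where $\overline{m}(F)=\frac{1}{m(\mathbb{R})}\int F\,dm$ ($c=\infty$ is always admissible). Here $\wedge$, $\vee$ denote minimum and maximum. *)

theory Defs
  imports "HOL-Analysis.Analysis"
begin

text \<open>
  Throughout, \<open>S\<close> is a continuous strictly increasing function, \<open>interval_measure S\<close> is the
  Stieltjes measure \<open>dS\<close>, and \<open>m\<close> is a finite Borel measure on the real line.  As \<open>dS\<close> has no atoms,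
  it does not matter whether the endpoints are included in integrals against \<open>dS\<close>.
\<close>

definition locally_integrable :: "real measure \<Rightarrow> (real \<Rightarrow> real) \<Rightarrow> bool" where
  "locally_integrable M f \<longleftrightarrow> (\<forall>u v. set_integrable M {u..v} f)"

definition has_density_wrt :: "(real \<Rightarrow> real) \<Rightarrow> (real \<Rightarrow> real) \<Rightarrow> (real \<Rightarrow> real) \<Rightarrow> bool" where
  "has_density_wrt S F f \<longleftrightarrow>
     locally_integrable (interval_measure S) f \<and>
     (\<forall>u v. u < v \<longrightarrow> (LINT x:{u..v}|interval_measure S. f x) = F v - F u)"

definition abs_cont_wrt :: "(real \<Rightarrow> real) \<Rightarrow> (real \<Rightarrow> real) \<Rightarrow> bool" where
  "abs_cont_wrt S F \<longleftrightarrow> (\<exists>f. has_density_wrt S F f)"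

text \<open>The density is unique only up to \<open>dS\<close>-null sets; every use below is insensitive to the choice.\<close>

definition deriv_wrt :: "(real \<Rightarrow> real) \<Rightarrow> (real \<Rightarrow> real) \<Rightarrow> real \<Rightarrow> real" where
  "deriv_wrt S F = (SOME f. has_density_wrt S F f)"

definition L2 :: "real measure \<Rightarrow> (real \<Rightarrow> real) set" where
  "L2 M = {f \<in> borel_measurable M. integrable M (\<lambda>x. (f x)\<^sup>2)}"

definition test_functions :: "(real \<Rightarrow> real) \<Rightarrow> real measure \<Rightarrow> (real \<Rightarrow> real) set" where
  "test_functions S m =
     {F \<in> L2 m. abs_cont_wrt S F \<and> deriv_wrt S F \<in> L2 (interval_measure S)}"

text \<open>
  The best constants are infima in \<open>[0, \<infinity>]\<close>.  The constant \<open>\<infinity>\<close> is always admissible: an energy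
  equal to 0 forces the left-hand side to vanish, in accordance with \<open>\<infinity> * 0 = 0\<close>.
\<close>

definition A_plus :: "(real \<Rightarrow> real) \<Rightarrow> real measure \<Rightarrow> real \<Rightarrow> ennreal" where
  "A_plus S m a = Inf {A. \<forall>F\<in>test_functions S m.
     (\<integral>\<^sup>+x\<in>{a..}. ennreal ((F x - F a)\<^sup>2) \<partial>m)
       \<le> A * (\<integral>\<^sup>+x\<in>{a..}. ennreal ((deriv_wrt S F x)\<^sup>2) \<partial>interval_measure S)}"

definition A_minus :: "(real \<Rightarrow> real) \<Rightarrow> real measure \<Rightarrow> real \<Rightarrow> ennreal" where
  "A_minus S m a = Inf {A. \<forall>F\<in>test_functions S m.
     (\<integral>\<^sup>+x\<in>{..a}. ennreal ((F x - F a)\<^sup>2) \<partial>m)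
       \<le> A * (\<integral>\<^sup>+x\<in>{..a}. ennreal ((deriv_wrt S F x)\<^sup>2) \<partial>interval_measure S)}"

definition B_plus :: "(real \<Rightarrow> real) \<Rightarrow> real measure \<Rightarrow> real \<Rightarrow> ennreal" where
  "B_plus S m a = (SUP x\<in>{a..}. emeasure m {x<..} * ennreal (S x - S a))"

definition B_minus :: "(real \<Rightarrow> real) \<Rightarrow> real measure \<Rightarrow> real \<Rightarrow> ennreal" where
  "B_minus S m a = (SUP x\<in>{..a}. emeasure m {..<x} * ennreal (S a - S x))"

definition mean :: "real measure \<Rightarrow> (real \<Rightarrow> real) \<Rightarrow> real" where
  "mean m F = 1 / measure m UNIV * (LINT x|m. F x)"

definition poincare_const :: "(real \<Rightarrow> real) \<Rightarrow> real measure \<Rightarrow> ennreal" where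
  "poincare_const S m = Inf {c. \<forall>F\<in>test_functions S m.
     (\<integral>\<^sup>+x. ennreal ((F x - mean m F)\<^sup>2) \<partial>m)
       \<le> c * (\<integral>\<^sup>+x. ennreal ((deriv_wrt S F x)\<^sup>2) \<partial>interval_measure S)}"

end

theory Submission
  imports Defs
begin

text \<open>
  Lower bound: functions violating the two half-line inequalities at \<open>a\<close> with a constant \<open>c\<close>, frozen
  beyond \<open>a\<close> and combined so that the mean becomes the value at \<open>a\<close>, violate the Poincare inequality
  with constant \<open>c\<close>.  Upper bound: the mean minimises the quadratic deviation, so it may be replaced
  by \<open>F a\<close>, and both sides then split at \<open>a\<close>.

  Finiteness: the truncated scale functions, equal to \<open>S\<close> on an interval and constant on either side
  of it, have explicit energy.  They show that \<open>B\<close> is bounded by \<open>A\<close>, and that \<open>B\<close> is finite if the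
  Poincare constant is, first for a base point with mass behind it and then for every base point,
  because changing the base point changes \<open>B\<close> by a finite amount.  Conversely \<open>A \<le> 16 B\<close>, by the
  truncation proof of the Hardy inequality.
\<close>

section \<open>Densities with respect to the scale\<close>

text \<open>The positive and negative parts of \<open>h\<close>, taken as densities, give two finite
  measures that agree on all open rays and hence on all Borel sets. Uniqueness of densities then
  makes the two parts equal almost everywhere.\<close>

lemma AE_zero_if_integrals_Ioi_zero:
  fixes M :: "real measure" and h :: "real \<Rightarrow> real"
  assumes sets: "sets M = sets borel" and h: "integrable M h"
    and zero: "\<And>x. (LINT t:{x<..}|M. h t) = 0"
  shows "AE x in M. h x = 0"
proof -
  have sp: "space M = UNIV"
    using sets_eq_imp_space_eq[OF sets] by simp
  have hm[measurable]: "h \<in> borel_measurable M"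
    using h by simp
  have fin: "(\<integral>\<^sup>+x. ennreal (h x) \<partial>M) \<noteq> \<infinity>" "(\<integral>\<^sup>+x. ennreal (- h x) \<partial>M) \<noteq> \<infinity>"
    using h by (auto simp: real_integrable_def)
  have Ioi: "{x<..} \<in> sets M" for x :: real
    using sets by simp
  have em: "emeasure (density M (\<lambda>x. ennreal (g x))) {x<..} = (\<integral>\<^sup>+t\<in>{x<..}. ennreal (g t) \<partial>M)"
    if "g \<in> borel_measurable M" for g :: "real \<Rightarrow> real" and x
    using that Ioi by (simp add: emeasure_density)
  have "density M (\<lambda>x. ennreal (h x)) = density M (\<lambda>x. ennreal (- h x))"
  proof (rule measure_eqI_lessThan)
    fix x :: real
    have "(\<integral>\<^sup>+t\<in>{x<..}. ennreal (h t) \<partial>M) \<le> (\<integral>\<^sup>+t. ennreal (h t) \<partial>M)"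
      by (intro nn_integral_mono) (simp split: split_indicator)
    then show "emeasure (density M (\<lambda>x. ennreal (h x))) {x<..} < \<infinity>"
      using fin(1) by (simp add: em) (meson le_less_trans top.not_eq_extremum)
    have int: "integrable M (\<lambda>t. indicator {x<..} t * h t)"
      using integrable_mult_indicator[OF Ioi h, of x] by simp
    have i1: "(\<integral>\<^sup>+t. ennreal (indicator {x<..} t * h t) \<partial>M) = (\<integral>\<^sup>+t\<in>{x<..}. ennreal (h t) \<partial>M)"
      and i2: "(\<integral>\<^sup>+t. ennreal (- (indicator {x<..} t * h t)) \<partial>M) = (\<integral>\<^sup>+t\<in>{x<..}. ennreal (- h t) \<partial>M)"
      by (intro nn_integral_cong; simp split: split_indicator)+
    have "enn2real (\<integral>\<^sup>+t\<in>{x<..}. ennreal (h t) \<partial>M) = enn2real (\<integral>\<^sup>+t\<in>{x<..}. ennreal (- h t) \<partial>M)"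
      using zero[of x] real_lebesgue_integral_def[OF int]
      unfolding set_lebesgue_integral_def by (simp add: i1 i2)
    moreover have "(\<integral>\<^sup>+t\<in>{x<..}. ennreal (h t) \<partial>M) \<noteq> \<infinity>" "(\<integral>\<^sup>+t\<in>{x<..}. ennreal (- h t) \<partial>M) \<noteq> \<infinity>"
      using int by (auto simp: real_integrable_def i1 i2)
    ultimately show "emeasure (density M (\<lambda>x. ennreal (h x))) {x<..}
        = emeasure (density M (\<lambda>x. ennreal (- h x))) {x<..}"
      by (simp add: em) (metis ennreal_enn2real_if)
  qed (use sets in auto)
  then have "AE x in M. ennreal (h x) = ennreal (- h x)"
    by (subst (asm) finite_density_unique) (use fin in auto)
  \<comment> \<open>\<open>ennreal\<close> cuts negative values off at 0, so the equation identifies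
    the positive and negative parts at \<open>x\<close>, one of which is always 0.\<close>
  then show ?thesis
    by eventually_elim (metis add.inverse_neutral ennreal_eq_0_iff ennreal_inj le_cases neg_0_le_iff_le
        neg_le_0_iff_le order_antisym)
qed

locale scale_function =
  fixes S :: "real \<Rightarrow> real"
  assumes strict_mono_S: "strict_mono S"
    and continuous_S: "continuous_on UNIV S"
begin

abbreviation dS :: "real measure" where
  "dS \<equiv> interval_measure S"

section \<open>Null sets of the scale measure, measurability and uniqueness of densities\<close>

lemma S_mono: "x \<le> y \<Longrightarrow> S x \<le> S y"
  using strict_mono_S by (simp add: strict_mono_less_eq)

lemma emeasure_dS_Icc: "a \<le> b \<Longrightarrow> emeasure dS {a..b} = ennreal (S b - S a)"
  using emeasure_interval_measure_Icc[OF _ S_mono continuous_S] by auto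

lemma emeasure_dS_singleton: "emeasure dS {a} = 0"
  using emeasure_dS_Icc[of a a] by simp

lemma AE_dS_neq: "AE x in dS. x \<noteq> a"
  by (rule AE_I[where N="{a}"]) (auto simp: emeasure_dS_singleton)

text \<open>Only local integrability is built into \<open>has_density_wrt\<close>, so
  \<open>f\<close> is recovered as the pointwise limit of its integrable cut-offs to
  \<open>[-n, n]\<close>.\<close>

lemma has_density_measurable:
  assumes "has_density_wrt S F f"
  shows "f \<in> borel_measurable borel"
proof -
  have "(\<lambda>x. indicator {- real n..real n} x * f x) \<in> borel_measurable borel" for n
  proof -
    have "integrable dS (\<lambda>x. indicator {- real n..real n} x * f x)"
      using assms unfolding has_density_wrt_def locally_integrable_def set_integrable_def by simp
    then show ?thesis
      by (auto dest!: borel_measurable_integrable simp: measurable_cong_sets[OF sets_interval_measure refl])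
  qed
  moreover have "(\<lambda>n. indicator {- real n..real n} x * f x) \<longlonglongrightarrow> f x" for x
  proof (rule tendsto_eventually)
    obtain N :: nat where "\<bar>x\<bar> \<le> real N"
      using real_arch_simple by blast
    then show "\<forall>\<^sub>F n in sequentially. indicator {- real n..real n} x * f x = f x"
      unfolding eventually_sequentially by (intro exI[of _ N]) (auto split: split_indicator)
  qed
  ultimately show ?thesis
    by (rule borel_measurable_LIMSEQ_real[rotated])
qed

lemma has_density_integrable:
  "has_density_wrt S F f \<Longrightarrow> set_integrable dS {u..v} f"
  by (simp add: has_density_wrt_def locally_integrable_def)

lemma has_density_integral:
  assumes "has_density_wrt S F f" "u \<le> v"
  shows "(LINT x:{u..v}|dS. f x) = F v - F u"
proof (cases "u = v")
  case True
  have "(LINT x:{u}|dS. f x) = f u * measure dS {u}"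
    using has_density_integrable[OF assms(1), of u u]
    by (intro set_integral_at_point) (auto simp: emeasure_dS_singleton)
  then show ?thesis
    using True by (simp add: measure_def emeasure_dS_singleton)
next
  case False
  then show ?thesis
    using assms by (auto simp: has_density_wrt_def)
qed

text \<open>This makes the choice in \<open>deriv_wrt\<close> harmless. The difference has integral
  0 over every compact interval; once cut off to \<open>[-n, n]\<close> it is integrable on the
  line, so the criterion with rays applies, and countably many \<open>n\<close> suffice.\<close>

lemma has_density_AE_unique:
  assumes F: "has_density_wrt S F f" and G: "has_density_wrt S F g"
  shows "AE x in dS. f x = g x"
proof -
  have int: "set_integrable dS {u..v} (\<lambda>x. f x - g x)" for u v
    using set_integral_diff(1)[OF has_density_integrable[OF F] has_density_integrable[OF G]] .
  \<comment> \<open>Reversed endpoints are included because the interval starting at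
    \<open>max x (- real n)\<close> is empty for large \<open>x\<close>.\<close>
  have eq0: "(LINT x:{u..v}|dS. f x - g x) = 0" for u v
  proof (cases "u \<le> v")
    case True
    then show ?thesis
      using set_integral_diff(2)[OF has_density_integrable[OF F] has_density_integrable[OF G]]
        has_density_integral[OF F True] has_density_integral[OF G True] by simp
  qed (simp add: set_lebesgue_integral_def)
  have "AE x in dS. indicator {- real n..real n} x * (f x - g x) = 0" for n
  proof (rule AE_zero_if_integrals_Ioi_zero)
    show "integrable dS (\<lambda>x. indicator {- real n..real n} x * (f x - g x))"
      using int[of "- real n" "real n"] by (simp add: set_integrable_def)
    fix x
    have m[measurable]: "f \<in> borel_measurable borel" "g \<in> borel_measurable borel"
      using has_density_measurable F G by auto
    have "(LINT t:{x<..}|dS. indicator {- real n..real n} t * (f t - g t))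
        = (LINT t:{max x (- real n)..real n}|dS. f t - g t)"
      unfolding set_lebesgue_integral_def
    proof (intro integral_cong_AE)
      show "AE t in dS. indicator {x<..} t *\<^sub>R (indicator {- real n..real n} t * (f t - g t))
        = indicator {max x (- real n)..real n} t *\<^sub>R (f t - g t)"
        using AE_dS_neq[of x] by eventually_elim (auto split: split_indicator)
    qed measurable
    then show "(LINT t:{x<..}|dS. indicator {- real n..real n} t * (f t - g t)) = 0"
      by (simp add: eq0)
  qed simp
  then have "AE x in dS. \<forall>n. indicator {- real n..real n} x * (f x - g x) = 0"
    by (subst AE_all_countable) blast
  then show ?thesis
  proof eventually_elim
    fix x assume *: "\<forall>n. indicator {- real n..real n} x * (f x - g x) = 0"
    obtain N :: nat where "\<bar>x\<bar> \<le> real N"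
      using real_arch_simple by blast
    then show "f x = g x"
      using spec[OF *, of N] by (auto simp: indicator_def abs_le_iff split: if_splits)
  qed
qed

section \<open>Operations on functions with a density\<close>

lemma has_density_S: "has_density_wrt S S (\<lambda>_. 1)"
proof -
  have "set_integrable dS {u..v} (\<lambda>_. 1 :: real)" for u v
    by (cases "u \<le> v") (simp_all add: set_integrable_def emeasure_dS_Icc)
  moreover have "(LINT x:{u..v}|dS. 1) = S v - S u" if "u < v" for u v
    using that S_mono[of u v] by (simp add: set_lebesgue_integral_def measure_def emeasure_dS_Icc)
  ultimately show ?thesis
    by (simp add: has_density_wrt_def locally_integrable_def)
qed

lemma has_density_lin:
  assumes "has_density_wrt S F f" "has_density_wrt S G g"
  shows "has_density_wrt S (\<lambda>x. \<alpha> * F x + \<beta> * G x) (\<lambda>x. \<alpha> * f x + \<beta> * g x)"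
proof -
  note I = set_integrable_mult_right[of \<alpha>, OF has_density_integrable[OF assms(1)]]
    set_integrable_mult_right[of \<beta>, OF has_density_integrable[OF assms(2)]]
  show ?thesis
    unfolding has_density_wrt_def locally_integrable_def
    using set_integral_add[OF I]
    by (simp add: has_density_integral[OF assms(1)] has_density_integral[OF assms(2)] right_diff_distrib)
qed

text \<open>Freezing \<open>F\<close> at \<open>F a\<close> to the left of \<open>a\<close> removes
  the density there. Such functions serve for the lower bound on the Poincare constant and for the
  truncated scale.\<close>

lemma has_density_max:
  assumes "has_density_wrt S F f"
  shows "has_density_wrt S (\<lambda>x. F (max x a)) (\<lambda>x. indicator {a..} x * f x)"
proof -
  have eq: "indicator {u..v} x *\<^sub>R (indicator {a..} x * f x) = indicator {max u a..v} x *\<^sub>R f x" for u v x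
    by (auto split: split_indicator)
  have "(LINT x:{max u a..v}|dS. f x) = F (max v a) - F (max u a)" if "u < v" for u v
    by (cases "a \<le> v") (use that has_density_integral[OF assms, of "max u a" v] in
        \<open>auto simp: set_lebesgue_integral_def max_def\<close>)
  then show ?thesis
    using has_density_integrable[OF assms]
    unfolding has_density_wrt_def locally_integrable_def set_integrable_def set_lebesgue_integral_def eq
    by blast
qed

lemma has_density_min:
  assumes "has_density_wrt S F f"
  shows "has_density_wrt S (\<lambda>x. F (min x a)) (\<lambda>x. indicator {..a} x * f x)"
proof -
  have eq: "indicator {u..v} x *\<^sub>R (indicator {..a} x * f x) = indicator {u..min v a} x *\<^sub>R f x" for u v x
    by (auto split: split_indicator)
  have "(LINT x:{u..min v a}|dS. f x) = F (min v a) - F (min u a)" if "u < v" for u v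
    by (cases "u \<le> a") (use that has_density_integral[OF assms, of u "min v a"] in
        \<open>auto simp: set_lebesgue_integral_def min_def\<close>)
  then show ?thesis
    using has_density_integrable[OF assms]
    unfolding has_density_wrt_def locally_integrable_def set_integrable_def set_lebesgue_integral_def eq
    by blast
qed

text \<open>Cauchy-Schwarz for the integral of \<open>1 * f\<close> over \<open>{u..v}\<close>. The
  energy is taken on the open interval, so that consecutive intervals are disjoint in the Hardy
  inequality.\<close>

lemma has_density_square_le:
  assumes f: "has_density_wrt S F f" and "u \<le> v"
  shows "ennreal ((F v - F u)\<^sup>2)
    \<le> ennreal (S v - S u) * (\<integral>\<^sup>+x\<in>{u<..<v}. ennreal ((f x)\<^sup>2) \<partial>dS)"
proof -
  have [measurable]: "f \<in> borel_measurable borel"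
    by (rule has_density_measurable[OF f])
  have "\<bar>F v - F u\<bar> = \<bar>LINT x:{u..v}|dS. f x\<bar>"
    by (simp add: has_density_integral[OF f \<open>u \<le> v\<close>])
  also have "ennreal \<dots> \<le> (\<integral>\<^sup>+x. ennreal (norm (indicator {u..v} x *\<^sub>R f x)) \<partial>dS)"
    using integral_norm_bound_ennreal[of dS "\<lambda>x. indicator {u..v} x *\<^sub>R f x"]
      has_density_integrable[OF f, of u v]
    by (simp add: set_lebesgue_integral_def set_integrable_def)
  also have "\<dots> = (\<integral>\<^sup>+x. indicator {u..v} x * (indicator {u<..<v} x * ennreal \<bar>f x\<bar>) \<partial>dS)"
  proof (intro nn_integral_cong_AE)
    show "AE x in dS. ennreal (norm (indicator {u..v} x *\<^sub>R f x))
        = indicator {u..v} x * (indicator {u<..<v} x * ennreal \<bar>f x\<bar>)"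
      using AE_dS_neq[of u] AE_dS_neq[of v] by eventually_elim (auto split: split_indicator)
  qed
  finally have "(ennreal \<bar>F v - F u\<bar>)\<^sup>2
      \<le> (\<integral>\<^sup>+x. indicator {u..v} x * (indicator {u<..<v} x * ennreal \<bar>f x\<bar>) \<partial>dS)\<^sup>2"
    by (intro power_mono) auto
  also have "\<dots> \<le> (\<integral>\<^sup>+x. indicator {u..v} x ^ 2 \<partial>dS)
      * (\<integral>\<^sup>+x. (indicator {u<..<v} x * ennreal \<bar>f x\<bar>) ^ 2 \<partial>dS)"
    by (rule Cauchy_Schwarz_nn_integral) auto
  also have "(\<integral>\<^sup>+x. indicator {u..v} x ^ 2 \<partial>dS) = (\<integral>\<^sup>+x. indicator {u..v} x \<partial>dS)"
    by (intro nn_integral_cong) (simp split: split_indicator)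
  also have "\<dots> = ennreal (S v - S u)"
    using emeasure_dS_Icc[OF \<open>u \<le> v\<close>] by simp
  also have "(\<integral>\<^sup>+x. (indicator {u<..<v} x * ennreal \<bar>f x\<bar>) ^ 2 \<partial>dS)
      = (\<integral>\<^sup>+x\<in>{u<..<v}. ennreal ((f x)\<^sup>2) \<partial>dS)"
    by (intro nn_integral_cong) (auto simp: ennreal_power split: split_indicator)
  finally show ?thesis
    by (simp add: ennreal_power)
qed

end

section \<open>Hardy inequalities\<close>

text \<open>
  Let \<open>X k\<close> be the first point after \<open>a\<close> where \<open>\<bar>F\<bar>\<close> reaches the level \<open>2\<^sup>k\<close>.  Between \<open>X (k - 1)\<close> and \<open>X k\<close>
  the function moves by at least \<open>2\<^sup>k / 2\<close>, so the energy on that interval controls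
  \<open>4\<^sup>k / (S (X k) - S a)\<close>, and hence \<open>4\<^sup>k\<close> times the mass beyond \<open>X k\<close>.  The intervals are disjoint, so
  summing over the integers \<open>k\<close> gives the inequality.
\<close>

lemma hardy_inequality_Ici:
  fixes m \<mu> :: "real measure" and F S :: "real \<Rightarrow> real"
  assumes sets_m: "sets m = sets borel" and sets_\<mu>: "sets \<mu> = sets borel"
    and S_mono: "\<And>x y. x \<le> y \<Longrightarrow> S x \<le> S y"
    and cont: "continuous_on UNIV F" and Fa: "F a = 0"
    and energy: "\<And>x y. x < y \<Longrightarrow>
      ennreal ((F y - F x)\<^sup>2) \<le> ennreal (S y - S x) * emeasure \<mu> {x<..<y}"
    and B: "\<And>x. a \<le> x \<Longrightarrow> emeasure m {x<..} * ennreal (S x - S a) \<le> B"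
  shows "(\<integral>\<^sup>+x\<in>{a..}. ennreal ((F x)\<^sup>2) \<partial>m) \<le> 16 * B * emeasure \<mu> {a<..}"
proof -
  \<comment> \<open>All integers are needed as exponents: since \<open>F a = 0\<close>,
    \<open>F\<close> may take arbitrarily small nonzero values.\<close>
  define r :: "int \<Rightarrow> real" where "r k = 2 powr real_of_int k" for k
  define E where "E k = {x. a \<le> x \<and> r k < \<bar>F x\<bar>}" for k
  \<comment> \<open>\<open>L\<close> collects the levels that are exceeded. It is closed downwards,
    and outside it \<open>X k\<close> is an infimum of the empty set, whence the default
    \<open>{}\<close> in \<open>J\<close>.\<close>
  define L where "L = {k. E k \<noteq> {}}"
  define X where "X k = Inf (E k)" for k
  define J where "J k = (if k \<in> L then {X (k - 1)<..<X k} else {})" for k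
  have r_pos: "0 < r k" for k
    by (simp add: r_def)
  have r_half: "r (k - 1) = r k / 2" for k
    by (simp add: r_def powr_diff)
  have r_mono: "r j \<le> r k" if "j \<le> k" for j k
    using that by (simp add: r_def)
  have cont_abs: "continuous_on A (\<lambda>x. \<bar>F x\<bar>)" for A
    using continuous_on_subset[OF cont] by (intro continuous_intros) auto
  have bdd: "bdd_below (E k)" for k
    by (rule bdd_belowI[of _ a]) (simp add: E_def)
  have E_anti: "E k \<subseteq> E j" if "j \<le> k" for j k
    using r_mono[OF that] by (auto simp: E_def)
  have L_down: "j \<in> L" if "j \<le> k" "k \<in> L" for j k
    using E_anti[OF that(1)] that(2) by (auto simp: L_def)
  have X_mono: "X j \<le> X k" if "j \<le> k" "k \<in> L" for j k
    unfolding X_def using E_anti[OF that(1)] that(2) bdd by (intro cInf_superset_mono) (auto simp: L_def)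
  have X_ge: "a \<le> X k" if "k \<in> L" for k
    unfolding X_def using that by (intro cInf_greatest) (auto simp: E_def L_def)
  have FX: "\<bar>F (X k)\<bar> = r k" if "k \<in> L" for k
  proof (rule antisym)
    have "X k \<in> closure (E k)"
      unfolding X_def using that bdd by (intro closure_contains_Inf) (auto simp: L_def)
    moreover have "closed {x. r k \<le> \<bar>F x\<bar>}"
      using cont_abs by (intro closed_Collect_le) auto
    then have "closure (E k) \<subseteq> {x. r k \<le> \<bar>F x\<bar>}"
      by (intro closure_minimal) (auto simp: E_def)
    ultimately show "r k \<le> \<bar>F (X k)\<bar>"
      by auto
    \<comment> \<open>Starting from \<open>F a = 0\<close>, a value above \<open>r k\<close> at
      \<open>X k\<close> would force an intermediate value \<open>y\<close> at an earlier point of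
      \<open>E k\<close>, against the choice of \<open>X k\<close>.\<close>
    show "\<bar>F (X k)\<bar> \<le> r k"
    proof (rule ccontr)
      assume "\<not> \<bar>F (X k)\<bar> \<le> r k"
      then obtain y where y: "r k < y" "y < \<bar>F (X k)\<bar>"
        using dense[of "r k" "\<bar>F (X k)\<bar>"] by (auto simp: not_le)
      moreover have "\<bar>F a\<bar> \<le> y"
        using y(1) r_pos[of k] Fa by simp
      ultimately obtain z where z: "a \<le> z" "z \<le> X k" "\<bar>F z\<bar> = y"
        using IVT'[OF _ less_imp_le X_ge[OF \<open>k \<in> L\<close>] cont_abs] by metis
      then have "X k \<le> z"
        unfolding X_def using y bdd by (intro cInf_lower) (auto simp: E_def)
      then show False
        using z y by auto
    qed
  qed
  \<comment> \<open>The point \<open>X k\<close> itself is excluded because \<open>E k\<close> asks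
    for more than \<open>r k\<close>; the open ray is what the bound \<open>B\<close>
    measures.\<close>
  have E_sub: "E k \<subseteq> {X k<..}" for k
  proof
    fix x assume x: "x \<in> E k"
    then have "k \<in> L" "X k \<le> x"
      unfolding X_def using bdd by (auto simp: L_def intro: cInf_lower)
    then show "x \<in> {X k<..}"
      using FX[of k] x by (cases "x = X k") (auto simp: E_def)
  qed
  have E_meas[measurable]: "E k \<in> sets m" for k
  proof -
    have "open {x. r k < \<bar>F x\<bar>}"
      using cont_abs by (intro open_Collect_less) auto
    moreover have "E k = {a..} \<inter> {x. r k < \<bar>F x\<bar>}"
      by (auto simp: E_def)
    ultimately show ?thesis
      by (simp add: sets_m)
  qed
  have level: "ennreal ((r k)\<^sup>2) * emeasure m (E k) \<le> 4 * B * emeasure \<mu> (J k)" for k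
  proof (cases "k \<in> L")
    case True
    have L': "k - 1 \<in> L"
      using L_down[of "k - 1" k] True by simp
    have "X k \<in> E (k - 1)"
      using X_ge[OF True] FX[OF True] r_half[of k] r_pos[of k] by (simp add: E_def)
    then have less: "X (k - 1) < X k"
      using E_sub by blast
    have "r k / 2 \<le> \<bar>F (X k) - F (X (k - 1))\<bar>"
      using FX[OF True] FX[OF L'] r_half[of k] by linarith
    then have "(r k / 2)\<^sup>2 \<le> (F (X k) - F (X (k - 1)))\<^sup>2"
      using r_pos[of k] by (metis abs_le_square_iff abs_of_pos half_gt_zero)
    then have "ennreal ((r k)\<^sup>2) \<le> ennreal (4 * (F (X k) - F (X (k - 1)))\<^sup>2)"
      by (intro ennreal_leI) (simp add: power_divide)
    also have "\<dots> = 4 * ennreal ((F (X k) - F (X (k - 1)))\<^sup>2)"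
      by (simp add: ennreal_mult)
    also have "\<dots> \<le> 4 * (ennreal (S (X k) - S (X (k - 1))) * emeasure \<mu> (J k))"
      using energy[OF less] True by (intro mult_left_mono) (auto simp: J_def)
    \<comment> \<open>Lowering the base from \<open>X (k - 1)\<close> to \<open>a\<close> produces
      the scale factor that is paired with the mass of \<open>{X k<..}\<close> in
      \<open>B\<close>.\<close>
    also have "\<dots> \<le> 4 * (ennreal (S (X k) - S a) * emeasure \<mu> (J k))"
      using S_mono[OF X_ge[OF L']] by (intro mult_left_mono mult_right_mono ennreal_leI) auto
    finally have "ennreal ((r k)\<^sup>2) * emeasure m (E k)
        \<le> 4 * (ennreal (S (X k) - S a) * emeasure \<mu> (J k)) * emeasure m {X k<..}"
      using E_sub by (intro mult_mono emeasure_mono) (auto simp: sets_m)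
    also have "\<dots> = 4 * (emeasure m {X k<..} * ennreal (S (X k) - S a)) * emeasure \<mu> (J k)"
      by (simp add: mult_ac)
    also have "\<dots> \<le> 4 * B * emeasure \<mu> (J k)"
      using B[OF X_ge[OF True]] by (intro mult_left_mono mult_right_mono) auto
    finally show ?thesis .
  qed (simp add: L_def)
  have disj: "disjoint_family_on J UNIV"
  proof -
    have "J j \<inter> J k = {}" if "j < k" for j k
    proof (cases "j \<in> L \<and> k \<in> L")
      case True
      \<comment> \<open>The interval of \<open>j\<close> ends at \<open>X j\<close>, and that of
        \<open>k\<close> begins no earlier.\<close>
      then have "X j \<le> X (k - 1)"
        using that L_down[of "k - 1" k] by (intro X_mono) auto
      then show ?thesis
        using True by (auto simp: J_def)
    qed (auto simp: J_def)
    then show ?thesis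
      unfolding disjoint_family_on_def by (metis inf_commute linorder_neq_iff)
  qed
  have J_sub: "(\<Union>k. J k) \<subseteq> {a<..}"
  proof (rule UN_least)
    fix k
    show "J k \<subseteq> {a<..}"
      using X_ge[of "k - 1"] L_down[of "k - 1" k] by (auto simp: J_def)
  qed
  have J_meas: "J k \<in> sets \<mu>" for k
    by (simp add: J_def sets_\<mu>)
  \<comment> \<open>The single layer with \<open>r k < \<bar>F x\<bar> \<le> 2 * r k\<close> already
    dominates \<open>(F x)\<^sup>2\<close>. The factor 4 lost here and the factor 4 of
    \<open>level\<close> make up the 16.\<close>
  have pointwise: "ennreal ((F x)\<^sup>2) * indicator {a..} x
      \<le> (\<integral>\<^sup>+k. 4 * ennreal ((r k)\<^sup>2) * indicator (E k) x \<partial>count_space UNIV)" for x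
  proof (cases "a \<le> x \<and> F x \<noteq> 0")
    case True
    \<comment> \<open>Ceiling minus one rather than floor: \<open>r k < \<bar>F x\<bar>\<close> has
      to be strict also when \<open>\<bar>F x\<bar>\<close> is a power of 2.\<close>
    define k where "k = \<lceil>log 2 \<bar>F x\<bar>\<rceil> - 1"
    have k: "real_of_int k < log 2 \<bar>F x\<bar>" "log 2 \<bar>F x\<bar> \<le> real_of_int k + 1"
      unfolding k_def by linarith+
    have "r k < \<bar>F x\<bar>"
      using k(1) True unfolding r_def by (simp add: less_log_iff)
    then have "x \<in> E k"
      using True by (simp add: E_def)
    have "\<bar>F x\<bar> \<le> 2 * r k"
      using k(2) True unfolding r_def by (simp add: log_le_iff powr_add)
    then have "(F x)\<^sup>2 \<le> 4 * (r k)\<^sup>2"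
      using power_mono[of "\<bar>F x\<bar>" "2 * r k" 2] by (simp add: power_mult_distrib)
    then have "ennreal ((F x)\<^sup>2) \<le> ennreal (4 * (r k)\<^sup>2)"
      by (rule ennreal_leI)
    also have "\<dots> = 4 * ennreal ((r k)\<^sup>2) * indicator (E k) x"
      using \<open>x \<in> E k\<close> by (simp add: ennreal_mult)
    also have "\<dots> \<le> (\<integral>\<^sup>+k. 4 * ennreal ((r k)\<^sup>2) * indicator (E k) x \<partial>count_space UNIV)"
      by (rule nn_integral_ge_point) simp
    finally show ?thesis
      using True by simp
  qed (auto simp: indicator_def)
  have "(\<integral>\<^sup>+x\<in>{a..}. ennreal ((F x)\<^sup>2) \<partial>m)
      \<le> (\<integral>\<^sup>+x. (\<integral>\<^sup>+k. 4 * ennreal ((r k)\<^sup>2) * indicator (E k) x \<partial>count_space UNIV) \<partial>m)"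
    by (intro nn_integral_mono pointwise)
  also have "\<dots> = (\<integral>\<^sup>+k. (\<integral>\<^sup>+x. 4 * ennreal ((r k)\<^sup>2) * indicator (E k) x \<partial>m) \<partial>count_space UNIV)"
    by (intro nn_integral_count_space_nn_integral) auto
  also have "\<dots> = (\<integral>\<^sup>+k. 4 * (ennreal ((r k)\<^sup>2) * emeasure m (E k)) \<partial>count_space UNIV)"
    by (intro nn_integral_cong) (simp add: nn_integral_cmult_indicator flip: mult.assoc)
  also have "\<dots> \<le> (\<integral>\<^sup>+k. 4 * (4 * B * emeasure \<mu> (J k)) \<partial>count_space UNIV)"
    by (intro nn_integral_mono mult_left_mono level) auto
  also have "\<dots> = 16 * B * (\<integral>\<^sup>+k. emeasure \<mu> (J k) \<partial>count_space UNIV)"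
    by (simp add: nn_integral_cmult mult.assoc[symmetric])
  also have "(\<integral>\<^sup>+k. emeasure \<mu> (J k) \<partial>count_space UNIV) = emeasure \<mu> (\<Union>k. J k)"
    using disj J_meas by (intro emeasure_UN_countable[symmetric]) auto
  also have "16 * B * \<dots> \<le> 16 * B * emeasure \<mu> {a<..}"
    using J_sub by (intro mult_left_mono emeasure_mono) (auto simp: sets_\<mu>)
  finally show ?thesis .
qed

text \<open>Reflection at 0: the inequality on \<open>{-a..}\<close> is applied to the images of
  \<open>m\<close> and \<open>\<mu>\<close> under \<open>uminus\<close> and to the reflected scale
  \<open>- S (- x)\<close>, which is again monotone.\<close>

lemma hardy_inequality_Iic:
  fixes m \<mu> :: "real measure" and F S :: "real \<Rightarrow> real"
  assumes sets_m: "sets m = sets borel" and sets_\<mu>: "sets \<mu> = sets borel"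
    and S_mono: "\<And>x y. x \<le> y \<Longrightarrow> S x \<le> S y"
    and cont: "continuous_on UNIV F" and Fa: "F a = 0"
    and energy: "\<And>x y. x < y \<Longrightarrow>
      ennreal ((F y - F x)\<^sup>2) \<le> ennreal (S y - S x) * emeasure \<mu> {x<..<y}"
    and B: "\<And>x. x \<le> a \<Longrightarrow> emeasure m {..<x} * ennreal (S a - S x) \<le> B"
  shows "(\<integral>\<^sup>+x\<in>{..a}. ennreal ((F x)\<^sup>2) \<partial>m) \<le> 16 * B * emeasure \<mu> {..<a}"
proof -
  have meas: "uminus \<in> measurable m borel" "uminus \<in> measurable \<mu> (borel :: real measure)"
    by (simp_all add: measurable_cong_sets[OF sets_m refl] measurable_cong_sets[OF sets_\<mu> refl])
  have space: "space m = UNIV" "space \<mu> = UNIV"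
    using sets_eq_imp_space_eq[OF sets_m] sets_eq_imp_space_eq[OF sets_\<mu>] by simp_all
  have vimage: "uminus -` {x<..} = {..<-x}" "uminus -` {x<..<y} = {-y<..<-x}" for x y :: real
    by auto
  have [measurable]: "F \<in> borel_measurable borel"
    using cont by (rule borel_measurable_continuous_onI)
  have "(\<integral>\<^sup>+x\<in>{-a..}. ennreal ((F (- x))\<^sup>2) \<partial>distr m borel uminus)
      \<le> 16 * B * emeasure (distr \<mu> borel uminus) {-a<..}"
  proof (rule hardy_inequality_Ici[where S="\<lambda>x. - S (- x)"])
    show "continuous_on UNIV (\<lambda>x. F (- x))"
      by (intro continuous_on_compose2[OF cont] continuous_intros) auto
    show "ennreal ((F (- y) - F (- x))\<^sup>2)
      \<le> ennreal (- S (- y) - (- S (- x))) * emeasure (distr \<mu> borel uminus) {x<..<y}" if "x < y" for x y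
      using energy[of "- y" "- x"] that
      by (simp add: emeasure_distr[OF meas(2)] space vimage power2_commute)
    show "emeasure (distr m borel uminus) {x<..} * ennreal (- S (- x) - (- S (- (- a)))) \<le> B"
      if "- a \<le> x" for x
      using B[of "- x"] that by (simp add: emeasure_distr[OF meas(1)] space vimage)
  qed (use S_mono Fa in auto)
  moreover have "(\<integral>\<^sup>+x\<in>{-a..}. ennreal ((F (- x))\<^sup>2) \<partial>distr m borel uminus)
      = (\<integral>\<^sup>+x\<in>{..a}. ennreal ((F x)\<^sup>2) \<partial>m)"
    by (subst nn_integral_distr[OF meas(1)]) (auto intro!: nn_integral_cong split: split_indicator)
  ultimately show ?thesis
    by (simp add: emeasure_distr[OF meas(2)] space vimage)
qed

section \<open>Test functions\<close>

lemma L2_measurable: "F \<in> L2 M \<Longrightarrow> F \<in> borel_measurable M"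
  by (simp add: L2_def)

lemma L2_square_integrable: "F \<in> L2 M \<Longrightarrow> integrable M (\<lambda>x. (F x)\<^sup>2)"
  by (simp add: L2_def)

lemma L2_bound:
  assumes "f \<in> borel_measurable M" "integrable M g" "\<And>x. (f x)\<^sup>2 \<le> g x"
  shows "f \<in> L2 M"
proof -
  have "norm ((f x)\<^sup>2) \<le> norm (g x)" for x
    using assms(3)[of x] by simp
  then have "integrable M (\<lambda>x. (f x)\<^sup>2)"
    using assms(1) by (intro Bochner_Integration.integrable_bound[OF assms(2)] AE_I2) simp_all
  then show ?thesis
    using assms(1) by (simp add: L2_def)
qed

lemma L2_lin:
  assumes "F \<in> L2 M" "G \<in> L2 M"
  shows "(\<lambda>x. \<alpha> * F x + \<beta> * G x) \<in> L2 M"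
proof (rule L2_bound)
  show "integrable M (\<lambda>x. 2 * \<alpha>\<^sup>2 * (F x)\<^sup>2 + 2 * \<beta>\<^sup>2 * (G x)\<^sup>2)"
    using assms by (intro Bochner_Integration.integrable_add integrable_mult_right L2_square_integrable)
  \<comment> \<open>The difference of the two sides is the square of
    \<open>\<alpha> * F x - \<beta> * G x\<close>.\<close>
  show "(\<alpha> * F x + \<beta> * G x)\<^sup>2 \<le> 2 * \<alpha>\<^sup>2 * (F x)\<^sup>2 + 2 * \<beta>\<^sup>2 * (G x)\<^sup>2" for x
    using zero_le_power2[of "\<alpha> * F x - \<beta> * G x"] by (simp add: power2_eq_square algebra_simps)
  show "(\<lambda>x. \<alpha> * F x + \<beta> * G x) \<in> borel_measurable M"
    using assms[THEN L2_measurable] by measurable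
qed

context scale_function
begin

text \<open>By Cauchy-Schwarz \<open>(F v - F u)\<^sup>2\<close> is at most \<open>S v - S u\<close>
  times the total energy, so \<open>F\<close> inherits continuity from \<open>S\<close>. The Hardy
  inequality relies on this to hit its levels.\<close>

lemma has_density_continuous:
  assumes f: "has_density_wrt S F f" and L2: "f \<in> L2 dS"
  shows "continuous_on UNIV F"
proof -
  define E where "E = (LINT x|dS. (f x)\<^sup>2)"
  have E: "(\<integral>\<^sup>+x. ennreal ((f x)\<^sup>2) \<partial>dS) = ennreal E" "0 \<le> E"
    unfolding E_def using L2_square_integrable[OF L2] by (auto intro: nn_integral_eq_integral)
  have *: "(F v - F u)\<^sup>2 \<le> (S v - S u) * E" if "u \<le> v" for u v
  proof -
    have "ennreal ((F v - F u)\<^sup>2) \<le> ennreal (S v - S u) * (\<integral>\<^sup>+x\<in>{u<..<v}. ennreal ((f x)\<^sup>2) \<partial>dS)"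
      by (rule has_density_square_le[OF f that])
    also have "\<dots> \<le> ennreal (S v - S u) * (\<integral>\<^sup>+x. ennreal ((f x)\<^sup>2) \<partial>dS)"
      by (intro mult_left_mono nn_integral_mono) (auto split: split_indicator)
    also have "\<dots> = ennreal ((S v - S u) * E)"
      using E S_mono[OF that] by (simp add: ennreal_mult)
    finally show ?thesis
      using E S_mono[OF that] by simp
  qed
  have "(F \<longlongrightarrow> F x) (at x)" for x
  proof -
    have bound: "(F y - F x)\<^sup>2 \<le> \<bar>S y - S x\<bar> * E" for y
      using *[of x y] *[of y x] S_mono[of x y] S_mono[of y x]
      by (cases "x \<le> y") (auto simp: power2_commute[of "F x"])
    have "(S \<longlongrightarrow> S x) (at x)"
      using continuous_S by (simp add: continuous_on_def)
    then have "((\<lambda>y. \<bar>S y - S x\<bar> * E) \<longlongrightarrow> \<bar>S x - S x\<bar> * E) (at x)"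
      by (intro tendsto_intros)
    then have "((\<lambda>y. \<bar>S y - S x\<bar> * E) \<longlongrightarrow> 0) (at x)"
      by simp
    then have "((\<lambda>y. (F y - F x)\<^sup>2) \<longlongrightarrow> 0) (at x)"
      by (rule tendsto_sandwich[OF _ _ tendsto_const, rotated 2]) (auto simp: bound)
    then have "((\<lambda>y. sqrt ((F y - F x)\<^sup>2)) \<longlongrightarrow> sqrt 0) (at x)"
      by (rule tendsto_real_sqrt)
    then show ?thesis
      by (simp add: tendsto_rabs_zero_iff LIM_zero_iff)
  qed
  then show ?thesis
    by (simp add: continuous_on_def)
qed

end

locale scale_and_speed = scale_function S for S +
  fixes m :: "real measure"
  assumes sets_m[measurable_cong]: "sets m = sets borel"
    and m_pos: "0 < emeasure m UNIV"
    and m_finite: "emeasure m UNIV < \<infinity>"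
begin

lemma space_m: "space m = UNIV"
  using sets_eq_imp_space_eq[OF sets_m] by simp

sublocale finite_measure m
  by (rule finite_measureI) (use m_finite in \<open>simp add: space_m\<close>)

lemma L2_integrable: "F \<in> L2 m \<Longrightarrow> integrable m F"
  by (rule square_integrable_imp_integrable[OF L2_measurable L2_square_integrable])

lemma emeasure_m_le: "emeasure m A \<le> emeasure m UNIV"
  using emeasure_space[of m A] by (simp add: space_m)

lemma measure_m_pos: "0 < measure m UNIV"
  using m_pos m_finite by (simp add: measure_def enn2real_positive_iff)

lemma measurable_m: "F \<in> borel_measurable m \<longleftrightarrow> F \<in> borel_measurable borel"
  by (simp add: measurable_cong_sets[OF sets_m refl])

section \<open>Test functions, their chosen derivatives, and freezing at a point\<close>

lemma test_function_density:
  assumes "F \<in> test_functions S m"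
  shows "has_density_wrt S F (deriv_wrt S F)"
proof -
  obtain f where "has_density_wrt S F f"
    using assms by (auto simp: test_functions_def abs_cont_wrt_def)
  then show ?thesis
    unfolding deriv_wrt_def by (rule someI[of "has_density_wrt S F"])
qed

lemma test_function_L2:
  assumes "F \<in> test_functions S m"
  shows "F \<in> L2 m" "deriv_wrt S F \<in> L2 dS"
  using assms by (auto simp: test_functions_def)

lemma deriv_measurable:
  "F \<in> test_functions S m \<Longrightarrow> deriv_wrt S F \<in> borel_measurable borel"
  by (rule has_density_measurable[OF test_function_density])

lemma test_function_continuous:
  "F \<in> test_functions S m \<Longrightarrow> continuous_on UNIV F"
  using has_density_continuous test_function_density test_function_L2 by blast

text \<open>\<open>deriv_wrt\<close> picks some density, a priori not \<open>f\<close>; almost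
  everywhere uniqueness carries the values of \<open>f\<close> and its square integrability over to
  the chosen one.\<close>

lemma test_functionI:
  assumes F: "has_density_wrt S F f" and L2: "f \<in> L2 dS" "F \<in> L2 m"
  shows "F \<in> test_functions S m" "AE x in dS. deriv_wrt S F x = f x"
proof -
  have D: "has_density_wrt S F (deriv_wrt S F)"
    using F unfolding deriv_wrt_def by (rule someI[of "has_density_wrt S F"])
  then show AE: "AE x in dS. deriv_wrt S F x = f x"
    using F by (rule has_density_AE_unique)
  have [measurable]: "f \<in> borel_measurable borel" "deriv_wrt S F \<in> borel_measurable borel"
    using D F has_density_measurable by auto
  have "integrable dS (\<lambda>x. (deriv_wrt S F x)\<^sup>2) \<longleftrightarrow> integrable dS (\<lambda>x. (f x)\<^sup>2)"
    using AE by (intro integrable_cong_AE) auto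
  then have "deriv_wrt S F \<in> L2 dS"
    using L2 by (simp add: L2_def)
  then show "F \<in> test_functions S m"
    using D L2 by (auto simp: test_functions_def abs_cont_wrt_def)
qed

lemma test_function_lin:
  assumes F: "F \<in> test_functions S m" and G: "G \<in> test_functions S m"
  shows "(\<lambda>x. \<alpha> * F x + \<beta> * G x) \<in> test_functions S m"
    and "AE x in dS. deriv_wrt S (\<lambda>x. \<alpha> * F x + \<beta> * G x) x
      = \<alpha> * deriv_wrt S F x + \<beta> * deriv_wrt S G x"
  by (fact test_functionI[OF has_density_lin[OF F[THEN test_function_density] G[THEN test_function_density]]
        L2_lin[OF F[THEN test_function_L2(2)] G[THEN test_function_L2(2)]]
        L2_lin[OF F[THEN test_function_L2(1)] G[THEN test_function_L2(1)]]])+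

text \<open>Covers both ways of freezing a function: each value is either the old one or
  \<open>F a\<close>, and constants are square integrable for the finite measure
  \<open>m\<close>.\<close>

lemma L2_clamp:
  assumes F: "F \<in> test_functions S m" and "\<And>x. g x = x \<or> g x = a" "g \<in> borel_measurable borel"
  shows "(\<lambda>x. F (g x)) \<in> L2 m"
proof (rule L2_bound)
  have [measurable]: "F \<in> borel_measurable borel"
    using test_function_L2[OF F] by (simp add: L2_def measurable_m)
  show "(\<lambda>x. F (g x)) \<in> borel_measurable m"
    using assms(3) by measurable
  show "integrable m (\<lambda>x. (F x)\<^sup>2 + (F a)\<^sup>2)"
    using L2_square_integrable[OF test_function_L2(1)[OF F]] by (intro Bochner_Integration.integrable_add) auto
  show "(F (g x))\<^sup>2 \<le> (F x)\<^sup>2 + (F a)\<^sup>2" for x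
    using assms(2)[of x] by auto
qed

lemma L2_cut:
  assumes "f \<in> L2 dS" "A \<in> sets borel"
  shows "(\<lambda>x. indicator A x * f x) \<in> L2 dS"
  using assms by (intro L2_bound[OF _ L2_square_integrable[OF assms(1)]])
    (auto simp: L2_def power_mult_distrib split: split_indicator)

lemma test_function_max:
  assumes F: "F \<in> test_functions S m"
  shows "(\<lambda>x. F (max x a)) \<in> test_functions S m"
    and "AE x in dS. deriv_wrt S (\<lambda>x. F (max x a)) x = indicator {a..} x * deriv_wrt S F x"
proof -
  have L2: "(\<lambda>x. F (max x a)) \<in> L2 m"
    by (rule L2_clamp[OF F, of _ a]) (auto simp: max_def)
  note I = test_functionI[OF has_density_max[OF test_function_density[OF F]]
      L2_cut[OF test_function_L2(2)[OF F]] L2]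
  show "(\<lambda>x. F (max x a)) \<in> test_functions S m"
    by (rule I) simp
  show "AE x in dS. deriv_wrt S (\<lambda>x. F (max x a)) x = indicator {a..} x * deriv_wrt S F x"
    by (rule I) simp
qed

lemma test_function_min:
  assumes F: "F \<in> test_functions S m"
  shows "(\<lambda>x. F (min x a)) \<in> test_functions S m"
    and "AE x in dS. deriv_wrt S (\<lambda>x. F (min x a)) x = indicator {..a} x * deriv_wrt S F x"
proof -
  have L2: "(\<lambda>x. F (min x a)) \<in> L2 m"
    by (rule L2_clamp[OF F, of _ a]) (auto simp: min_def)
  note I = test_functionI[OF has_density_min[OF test_function_density[OF F]]
      L2_cut[OF test_function_L2(2)[OF F]] L2]
  show "(\<lambda>x. F (min x a)) \<in> test_functions S m"
    by (rule I) simp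
  show "AE x in dS. deriv_wrt S (\<lambda>x. F (min x a)) x = indicator {..a} x * deriv_wrt S F x"
    by (rule I) simp
qed

section \<open>Truncated scale functions\<close>

text \<open>For \<open>a \<le> b\<close> the density is 1 on \<open>{a..b}\<close> and 0 elsewhere,
  so both the increment and the energy are \<open>S b - S a\<close>: the equality case of the
  Cauchy-Schwarz bound.\<close>

definition clip :: "real \<Rightarrow> real \<Rightarrow> real \<Rightarrow> real" where
  "clip a b x = S (min (max x a) b)"

lemma clip_test_function:
  assumes "a \<le> b"
  shows "clip a b \<in> test_functions S m"
    and "AE x in dS. deriv_wrt S (clip a b) x = indicator {a..b} x"
proof -
  have eq: "(\<lambda>x. indicator {a..} x * (indicator {..b} x * 1)) = (indicator {a..b} :: real \<Rightarrow> real)"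
    by (auto split: split_indicator)
  have dens: "has_density_wrt S (clip a b) (indicator {a..b})"
    using has_density_max[OF has_density_min[OF has_density_S, of b], of a]
    unfolding eq clip_def by simp
  have [measurable]: "S \<in> borel_measurable borel"
    using continuous_S by (rule borel_measurable_continuous_onI)
  have "(indicator {a..b} :: real \<Rightarrow> real) \<in> L2 dS"
    by (rule L2_bound[where g="indicator {a..b}"])
      (use emeasure_dS_Icc[OF assms] in \<open>auto split: split_indicator\<close>)
  moreover have "clip a b \<in> L2 m"
  proof (rule L2_bound)
    show "clip a b \<in> borel_measurable m"
      unfolding clip_def measurable_m by measurable
    show "integrable m (\<lambda>_. (S a)\<^sup>2 + (S b)\<^sup>2)"
      by simp
    fix x
    have "S a \<le> clip a b x" "clip a b x \<le> S b"
      unfolding clip_def using assms by (auto intro!: S_mono)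
    then have "\<bar>clip a b x\<bar> \<le> max \<bar>S a\<bar> \<bar>S b\<bar>"
      by auto
    then have "(clip a b x)\<^sup>2 \<le> (max \<bar>S a\<bar> \<bar>S b\<bar>)\<^sup>2"
      by (metis abs_ge_zero power2_abs power_mono)
    also have "\<dots> \<le> (S a)\<^sup>2 + (S b)\<^sup>2"
      by (simp add: max_def)
    finally show "(clip a b x)\<^sup>2 \<le> (S a)\<^sup>2 + (S b)\<^sup>2" .
  qed
  ultimately show "clip a b \<in> test_functions S m"
    and "AE x in dS. deriv_wrt S (clip a b) x = indicator {a..b} x"
    using test_functionI[OF dens] by auto
qed

lemma clip_energy:
  assumes "a \<le> b" "A \<in> sets borel" "{a..b} \<subseteq> A"
  shows "(\<integral>\<^sup>+x\<in>A. ennreal ((deriv_wrt S (clip a b) x)\<^sup>2) \<partial>dS) = ennreal (S b - S a)"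
proof -
  have "(\<integral>\<^sup>+x\<in>A. ennreal ((deriv_wrt S (clip a b) x)\<^sup>2) \<partial>dS) = (\<integral>\<^sup>+x. indicator {a..b} x \<partial>dS)"
  proof (intro nn_integral_cong_AE)
    show "AE x in dS. ennreal ((deriv_wrt S (clip a b) x)\<^sup>2) * indicator A x = indicator {a..b} x"
      using clip_test_function(2)[OF assms(1)] by eventually_elim (use assms(3) in \<open>auto split: split_indicator\<close>)
  qed
  then show ?thesis
    using emeasure_dS_Icc[OF assms(1)] by simp
qed

section \<open>Mean and variance\<close>

lemma mean_eq: "(LINT x|m. F x) = mean m F * measure m UNIV"
  using measure_m_pos by (simp add: mean_def)

text \<open>Replacing the mean by \<open>k\<close> adds exactly
  \<open>(mean m F - k)\<^sup>2 * measure m UNIV\<close>. In the upper bound \<open>k\<close> is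
  \<open>F a\<close>.\<close>

lemma variance_le:
  assumes F: "F \<in> L2 m"
  shows "(\<integral>\<^sup>+x. ennreal ((F x - mean m F)\<^sup>2) \<partial>m) \<le> (\<integral>\<^sup>+x. ennreal ((F x - k)\<^sup>2) \<partial>m)"
proof -
  have sq: "integrable m (\<lambda>x. (F x - l)\<^sup>2)" for l
    using L2_square_integrable[OF F] L2_integrable[OF F] by (simp add: power2_diff)
  have expand: "(LINT x|m. (F x - l)\<^sup>2)
      = (LINT x|m. (F x)\<^sup>2) - 2 * l * (LINT x|m. F x) + l\<^sup>2 * measure m UNIV" for l
    using L2_square_integrable[OF F] L2_integrable[OF F] by (simp add: power2_diff space_m mult_ac)
  have "(LINT x|m. (F x - k)\<^sup>2)
      = (LINT x|m. (F x - mean m F)\<^sup>2) + (mean m F - k)\<^sup>2 * measure m UNIV"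
    unfolding expand mean_eq by (simp add: power2_eq_square algebra_simps)
  then have "(LINT x|m. (F x - mean m F)\<^sup>2) \<le> (LINT x|m. (F x - k)\<^sup>2)"
    by simp
  then show ?thesis
    using sq by (simp add: nn_integral_eq_integral)
qed

end

section \<open>Half-line constants and the Poincare constant\<close>

lemma not_in_if_less_Inf: "c < Inf A \<Longrightarrow> c \<notin> A" for c :: "'a::complete_linorder"
  using Inf_lower[of c A] by auto

text \<open>Finiteness of \<open>X\<close> and \<open>Y\<close> moves the claim to the reals, where
  one positive weight is enough for strictness.\<close>

lemma add_mult_strict_mono_ennreal:
  fixes P Q X Y :: ennreal and u v :: real
  assumes "P < X" "X < \<infinity>" "Q < Y" "Y < \<infinity>" "0 \<le> u" "0 \<le> v" "0 < u \<or> 0 < v"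
  shows "ennreal u * P + ennreal v * Q < ennreal u * X + ennreal v * Y"
proof -
  have "P < \<infinity>" "Q < \<infinity>"
    using assms by auto
  with assms obtain p q x y where eq: "P = ennreal p" "Q = ennreal q" "X = ennreal x" "Y = ennreal y"
    and pos: "0 \<le> p" "0 \<le> q" "0 \<le> x" "0 \<le> y"
    by (metis ennreal_cases infinity_ennreal_def less_irrefl)
  have less: "p < x" "q < y"
    using assms(1,3) pos by (simp_all add: eq ennreal_less_iff)
  have "u * p + v * q < u * x + v * y"
    using assms(7)
  proof
    assume "0 < u"
    then show ?thesis
      using less assms(6) by (intro add_less_le_mono mult_strict_left_mono mult_left_mono) auto
  next
    assume "0 < v"
    then show ?thesis
      using less assms(5) by (intro add_le_less_mono mult_strict_left_mono mult_left_mono) auto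
  qed
  then have "ennreal (u * p + v * q) < ennreal (u * x + v * y)"
    using pos assms(5,6) by (subst ennreal_less_iff) auto
  then show ?thesis
    using pos assms by (simp add: eq ennreal_mult)
qed

context scale_and_speed
begin

abbreviation energy :: "real set \<Rightarrow> (real \<Rightarrow> real) \<Rightarrow> ennreal" where
  "energy A F \<equiv> (\<integral>\<^sup>+x\<in>A. ennreal ((deriv_wrt S F x)\<^sup>2) \<partial>dS)"

text \<open>The point \<open>a\<close> is counted twice on the right, which is harmless since
  \<open>dS\<close> has no atoms.\<close>

lemma energy_split:
  assumes "F \<in> test_functions S m"
  shows "energy UNIV F = energy {a..} F + energy {..a} F"
proof -
  have [measurable]: "deriv_wrt S F \<in> borel_measurable borel"
    by (rule deriv_measurable[OF assms])
  have "energy UNIV F = (\<integral>\<^sup>+x. ennreal ((deriv_wrt S F x)\<^sup>2) * indicator {a..} x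
      + ennreal ((deriv_wrt S F x)\<^sup>2) * indicator {..a} x \<partial>dS)"
  proof (intro nn_integral_cong_AE)
    show "AE x in dS. ennreal ((deriv_wrt S F x)\<^sup>2) * indicator UNIV x
      = ennreal ((deriv_wrt S F x)\<^sup>2) * indicator {a..} x + ennreal ((deriv_wrt S F x)\<^sup>2) * indicator {..a} x"
      using AE_dS_neq[of a] by eventually_elim (auto split: split_indicator)
  qed
  then show ?thesis
    by (simp add: nn_integral_add)
qed

section \<open>Comparison of the half-line constants with \<open>B\<close>\<close>

text \<open>The test function is \<open>clip a x\<close>: beyond \<open>x\<close> it deviates from
  its value at \<open>a\<close> by \<open>d\<close>, and its energy is also \<open>d\<close>. An
  admissible \<open>A\<close> therefore bounds \<open>d\<^sup>2\<close> times the mass of the tail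
  by \<open>A * d\<close>, and one factor \<open>d\<close> cancels.\<close>

lemma B_plus_le_A_plus: "B_plus S m a \<le> A_plus S m a"
  unfolding B_plus_def A_plus_def
proof (intro SUP_least Inf_greatest)
  fix x A
  assume "x \<in> {a..}" and A: "A \<in> {A. \<forall>F\<in>test_functions S m.
     (\<integral>\<^sup>+x\<in>{a..}. ennreal ((F x - F a)\<^sup>2) \<partial>m) \<le> A * energy {a..} F}"
  then have ax: "a \<le> x" by simp
  define d where "d = S x - S a"
  show "emeasure m {x<..} * ennreal (S x - S a) \<le> A"
  proof (cases "d = 0")
    case False
    then have d: "0 < d"
      using S_mono[OF ax] by (simp add: d_def)
    have "ennreal d * (emeasure m {x<..} * ennreal d) = ennreal (d\<^sup>2) * emeasure m {x<..}"
      using d by (simp add: power2_eq_square ennreal_mult mult_ac)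
    also have "\<dots> = (\<integral>\<^sup>+t. ennreal (d\<^sup>2) * indicator {x<..} t \<partial>m)"
      by (simp add: nn_integral_cmult_indicator sets_m)
    also have "\<dots> \<le> (\<integral>\<^sup>+t\<in>{a..}. ennreal ((clip a x t - clip a x a)\<^sup>2) \<partial>m)"
      using ax by (intro nn_integral_mono) (auto simp: clip_def d_def split: split_indicator)
    also have "\<dots> \<le> A * energy {a..} (clip a x)"
      using A clip_test_function(1)[OF ax] by blast
    also have "energy {a..} (clip a x) = ennreal d"
      unfolding d_def using ax by (intro clip_energy) auto
    finally have "ennreal d * (emeasure m {x<..} * ennreal d) \<le> ennreal d * A"
      by (simp add: mult.commute)
    then show ?thesis
      using d by (subst (asm) ennreal_mult_le_mult_iff) (auto simp: d_def)
  qed (simp add: d_def)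
qed

text \<open>The same test with \<open>clip x a\<close>, whose value at \<open>a\<close> is now its
  maximum.\<close>

lemma B_minus_le_A_minus: "B_minus S m a \<le> A_minus S m a"
  unfolding B_minus_def A_minus_def
proof (intro SUP_least Inf_greatest)
  fix x A
  assume "x \<in> {..a}" and A: "A \<in> {A. \<forall>F\<in>test_functions S m.
     (\<integral>\<^sup>+x\<in>{..a}. ennreal ((F x - F a)\<^sup>2) \<partial>m) \<le> A * energy {..a} F}"
  then have xa: "x \<le> a" by simp
  define d where "d = S a - S x"
  show "emeasure m {..<x} * ennreal (S a - S x) \<le> A"
  proof (cases "d = 0")
    case False
    then have d: "0 < d"
      using S_mono[OF xa] by (simp add: d_def)
    have "ennreal d * (emeasure m {..<x} * ennreal d) = ennreal (d\<^sup>2) * emeasure m {..<x}"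
      using d by (simp add: power2_eq_square ennreal_mult mult_ac)
    also have "\<dots> = (\<integral>\<^sup>+t. ennreal (d\<^sup>2) * indicator {..<x} t \<partial>m)"
      by (simp add: nn_integral_cmult_indicator sets_m)
    also have "\<dots> \<le> (\<integral>\<^sup>+t\<in>{..a}. ennreal ((clip x a t - clip x a a)\<^sup>2) \<partial>m)"
      using xa by (intro nn_integral_mono) (auto simp: clip_def d_def power2_commute split: split_indicator)
    also have "\<dots> \<le> A * energy {..a} (clip x a)"
      using A clip_test_function(1)[OF xa] by blast
    also have "energy {..a} (clip x a) = ennreal d"
      unfolding d_def using xa by (intro clip_energy) auto
    finally have "ennreal d * (emeasure m {..<x} * ennreal d) \<le> ennreal d * A"
      by (simp add: mult.commute)
    then show ?thesis
      using d by (subst (asm) ennreal_mult_le_mult_iff) (auto simp: d_def)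
  qed (simp add: d_def)
qed

text \<open>Reads the energy as a measure, the form in which the Hardy inequalities take it.\<close>

lemma emeasure_energy:
  assumes "F \<in> test_functions S m" "A \<in> sets borel"
  shows "emeasure (density dS (\<lambda>x. ennreal ((deriv_wrt S F x)\<^sup>2))) A = energy A F"
  using assms deriv_measurable[OF assms(1)] by (simp add: emeasure_density)

lemma energy_bound:
  assumes "F \<in> test_functions S m" "x < y"
  shows "ennreal ((F y - F x)\<^sup>2) \<le> ennreal (S y - S x)
    * emeasure (density dS (\<lambda>x. ennreal ((deriv_wrt S F x)\<^sup>2))) {x<..<y}"
  using has_density_square_le[OF test_function_density[OF assms(1)], of x y] assms(2)
  by (simp add: emeasure_energy[OF assms(1)])

text \<open>The Hardy inequality for \<open>F x - F a\<close>, with the energy of \<open>F\<close>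
  as \<open>\<mu>\<close>, shows that \<open>16 * B_plus S m a\<close> is itself an admissible
  constant.\<close>

lemma A_plus_le_B_plus: "A_plus S m a \<le> 16 * B_plus S m a"
  unfolding A_plus_def
proof (rule Inf_lower, clarify)
  fix F assume F: "F \<in> test_functions S m"
  define \<mu> where "\<mu> = density dS (\<lambda>x. ennreal ((deriv_wrt S F x)\<^sup>2))"
  have "(\<integral>\<^sup>+x\<in>{a..}. ennreal ((F x - F a)\<^sup>2) \<partial>m) \<le> 16 * B_plus S m a * emeasure \<mu> {a<..}"
  proof (rule hardy_inequality_Ici[OF sets_m _ S_mono])
    show "continuous_on UNIV (\<lambda>x. F x - F a)"
      using test_function_continuous[OF F] by (intro continuous_intros)
    show "emeasure m {x<..} * ennreal (S x - S a) \<le> B_plus S m a" if "a \<le> x" for x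
      unfolding B_plus_def using that by (intro SUP_upper) auto
    show "ennreal ((F y - F a - (F x - F a))\<^sup>2) \<le> ennreal (S y - S x) * emeasure \<mu> {x<..<y}"
      if "x < y" for x y
      using energy_bound[OF F that] by (simp add: \<mu>_def)
  qed (simp_all add: \<mu>_def)
  also have "emeasure \<mu> {a<..} \<le> emeasure \<mu> {a..}"
    by (intro emeasure_mono) (auto simp: \<mu>_def)
  also have "emeasure \<mu> {a..} = energy {a..} F"
    unfolding \<mu>_def by (rule emeasure_energy[OF F]) simp
  finally show "(\<integral>\<^sup>+x\<in>{a..}. ennreal ((F x - F a)\<^sup>2) \<partial>m) \<le> 16 * B_plus S m a * energy {a..} F"
    by (simp add: mult_left_mono)
qed

lemma A_minus_le_B_minus: "A_minus S m a \<le> 16 * B_minus S m a"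
  unfolding A_minus_def
proof (rule Inf_lower, clarify)
  fix F assume F: "F \<in> test_functions S m"
  define \<mu> where "\<mu> = density dS (\<lambda>x. ennreal ((deriv_wrt S F x)\<^sup>2))"
  have "(\<integral>\<^sup>+x\<in>{..a}. ennreal ((F x - F a)\<^sup>2) \<partial>m) \<le> 16 * B_minus S m a * emeasure \<mu> {..<a}"
  proof (rule hardy_inequality_Iic[OF sets_m _ S_mono])
    show "continuous_on UNIV (\<lambda>x. F x - F a)"
      using test_function_continuous[OF F] by (intro continuous_intros)
    show "emeasure m {..<x} * ennreal (S a - S x) \<le> B_minus S m a" if "x \<le> a" for x
      unfolding B_minus_def using that by (intro SUP_upper) auto
    show "ennreal ((F y - F a - (F x - F a))\<^sup>2) \<le> ennreal (S y - S x) * emeasure \<mu> {x<..<y}"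
      if "x < y" for x y
      using energy_bound[OF F that] by (simp add: \<mu>_def)
  qed (simp_all add: \<mu>_def)
  also have "emeasure \<mu> {..<a} \<le> emeasure \<mu> {..a}"
    by (intro emeasure_mono) (auto simp: \<mu>_def)
  also have "emeasure \<mu> {..a} = energy {..a} F"
    unfolding \<mu>_def by (rule emeasure_energy[OF F]) simp
  finally show "(\<integral>\<^sup>+x\<in>{..a}. ennreal ((F x - F a)\<^sup>2) \<partial>m) \<le> 16 * B_minus S m a * energy {..a} F"
    by (simp add: mult_left_mono)
qed

lemma A_plus_finite_iff: "A_plus S m a < \<infinity> \<longleftrightarrow> B_plus S m a < \<infinity>"
proof
  assume "B_plus S m a < \<infinity>"
  then have "16 * B_plus S m a < \<infinity>"
    by (simp add: ennreal_mult_less_top)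
  then show "A_plus S m a < \<infinity>"
    using A_plus_le_B_plus by (rule le_less_trans[rotated])
qed (rule le_less_trans[OF B_plus_le_A_plus])

lemma A_minus_finite_iff: "A_minus S m a < \<infinity> \<longleftrightarrow> B_minus S m a < \<infinity>"
proof
  assume "B_minus S m a < \<infinity>"
  then have "16 * B_minus S m a < \<infinity>"
    by (simp add: ennreal_mult_less_top)
  then show "A_minus S m a < \<infinity>"
    using A_minus_le_B_minus by (rule le_less_trans[rotated])
qed (rule le_less_trans[OF B_minus_le_A_minus])

section \<open>Dependence of \<open>B\<close> on the base point\<close>

text \<open>\<open>S x - S a\<close> is at most \<open>S x - S b\<close> plus
  \<open>\<bar>S b - S a\<bar>\<close>, and a ray has at most the total mass. For
  \<open>x < b\<close>, where the supremum based at \<open>b\<close> does not reach, the second term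
  alone suffices.\<close>

lemma B_plus_change_base:
  "B_plus S m a \<le> B_plus S m b + emeasure m UNIV * ennreal \<bar>S b - S a\<bar>"
  unfolding B_plus_def[of S m a]
proof (rule SUP_least)
  fix x assume "x \<in> {a..}"
  show "emeasure m {x<..} * ennreal (S x - S a) \<le> B_plus S m b + emeasure m UNIV * ennreal \<bar>S b - S a\<bar>"
  proof (cases "b \<le> x")
    case True
    have "ennreal (S x - S a) \<le> ennreal ((S x - S b) + \<bar>S b - S a\<bar>)"
      by (rule ennreal_leI) simp
    also have "\<dots> = ennreal (S x - S b) + ennreal \<bar>S b - S a\<bar>"
      using S_mono[OF True] by (intro ennreal_plus) auto
    finally have "ennreal (S x - S a) \<le> ennreal (S x - S b) + ennreal \<bar>S b - S a\<bar>" .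
    then have "emeasure m {x<..} * ennreal (S x - S a)
        \<le> emeasure m {x<..} * ennreal (S x - S b) + emeasure m {x<..} * ennreal \<bar>S b - S a\<bar>"
      by (metis distrib_left mult_left_mono zero_le)
    also have "\<dots> \<le> B_plus S m b + emeasure m UNIV * ennreal \<bar>S b - S a\<bar>"
      unfolding B_plus_def using True
      by (intro add_mono SUP_upper mult_right_mono emeasure_m_le) auto
    finally show ?thesis .
  next
    case False
    then have "S x - S a \<le> \<bar>S b - S a\<bar>"
      using S_mono[of x b] by simp
    then have "emeasure m {x<..} * ennreal (S x - S a) \<le> emeasure m UNIV * ennreal \<bar>S b - S a\<bar>"
      by (intro mult_mono emeasure_m_le ennreal_leI) auto
    then show ?thesis
      by (simp add: add_increasing)
  qed
qed

lemma B_minus_change_base: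
  "B_minus S m a \<le> B_minus S m b + emeasure m UNIV * ennreal \<bar>S b - S a\<bar>"
  unfolding B_minus_def[of S m a]
proof (rule SUP_least)
  fix x assume "x \<in> {..a}"
  show "emeasure m {..<x} * ennreal (S a - S x) \<le> B_minus S m b + emeasure m UNIV * ennreal \<bar>S b - S a\<bar>"
  proof (cases "x \<le> b")
    case True
    have "ennreal (S a - S x) \<le> ennreal ((S b - S x) + \<bar>S b - S a\<bar>)"
      by (rule ennreal_leI) simp
    also have "\<dots> = ennreal (S b - S x) + ennreal \<bar>S b - S a\<bar>"
      using S_mono[OF True] by (intro ennreal_plus) auto
    finally have "ennreal (S a - S x) \<le> ennreal (S b - S x) + ennreal \<bar>S b - S a\<bar>" .
    then have "emeasure m {..<x} * ennreal (S a - S x)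
        \<le> emeasure m {..<x} * ennreal (S b - S x) + emeasure m {..<x} * ennreal \<bar>S b - S a\<bar>"
      by (metis distrib_left mult_left_mono zero_le)
    also have "\<dots> \<le> B_minus S m b + emeasure m UNIV * ennreal \<bar>S b - S a\<bar>"
      unfolding B_minus_def using True
      by (intro add_mono SUP_upper mult_right_mono emeasure_m_le) auto
    finally show ?thesis .
  next
    case False
    then have "S a - S x \<le> \<bar>S b - S a\<bar>"
      using S_mono[of b x] by simp
    then have "emeasure m {..<x} * ennreal (S a - S x) \<le> emeasure m UNIV * ennreal \<bar>S b - S a\<bar>"
      by (intro mult_mono emeasure_m_le ennreal_leI) auto
    then show ?thesis
      by (simp add: add_increasing)
  qed
qed

lemma B_plus_finite_change_base: "B_plus S m b < \<infinity> \<Longrightarrow> B_plus S m a < \<infinity>"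
  using m_finite by (intro le_less_trans[OF B_plus_change_base[of a b]]) (simp add: ennreal_mult_less_top)

lemma B_minus_finite_change_base: "B_minus S m b < \<infinity> \<Longrightarrow> B_minus S m a < \<infinity>"
  using m_finite by (intro le_less_trans[OF B_minus_change_base[of a b]]) (simp add: ennreal_mult_less_top)

section \<open>Bounds on \<open>B\<close> from the Poincare inequality\<close>

definition poincare_admissible :: "ennreal \<Rightarrow> bool" where
  "poincare_admissible c \<longleftrightarrow> (\<forall>F\<in>test_functions S m.
     (\<integral>\<^sup>+x. ennreal ((F x - mean m F)\<^sup>2) \<partial>m) \<le> c * energy UNIV F)"

lemma poincare_const_eq: "poincare_const S m = Inf {c. poincare_admissible c}"
  by (simp add: poincare_const_def poincare_admissible_def)

text \<open>Whatever the mean of \<open>clip a b\<close> is, it differs by at least \<open>(S b - S a) / 2\<close> from one of the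
  two extreme values, which the function takes on \<open>{..a}\<close> and on \<open>{b..}\<close>.\<close>

lemma poincare_tail_bound:
  assumes c: "poincare_admissible c" and ab: "a \<le> b"
    and P: "P \<in> sets borel" "P \<subseteq> {..a}" and Q: "Q \<in> sets borel" "Q \<subseteq> {b..}"
  shows "emeasure m P * (emeasure m Q * ennreal (S b - S a)) \<le> 4 * emeasure m UNIV * c"
proof (cases "S b - S a = 0")
  case False
  define d where "d = S b - S a"
  define V where "V = (\<integral>\<^sup>+x. ennreal ((clip a b x - mean m (clip a b))\<^sup>2) \<partial>m)"
  have d: "0 < d"
    using False S_mono[OF ab] by (simp add: d_def)
  have V: "V \<le> c * ennreal d"
  proof -
    have "V \<le> c * energy UNIV (clip a b)"
      using c clip_test_function(1)[OF ab] unfolding poincare_admissible_def V_def by blast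
    also have "energy UNIV (clip a b) = ennreal d"
      unfolding d_def by (rule clip_energy[OF ab]) auto
    finally show ?thesis .
  qed
  \<comment> \<open>Chebyshev's inequality for deviations from the mean of size at least
    \<open>d / 2\<close>.\<close>
  have far: "ennreal ((d / 2)\<^sup>2) * emeasure m R \<le> V"
    if "R \<in> sets borel" "\<And>x. x \<in> R \<Longrightarrow> d / 2 \<le> \<bar>clip a b x - mean m (clip a b)\<bar>" for R
  proof -
    have "ennreal ((d / 2)\<^sup>2) * emeasure m R = (\<integral>\<^sup>+x. ennreal ((d / 2)\<^sup>2) * indicator R x \<partial>m)"
      using that(1) by (simp add: nn_integral_cmult_indicator sets_m)
    also have "\<dots> \<le> V"
      unfolding V_def
    proof (rule nn_integral_mono)
      fix x
      show "ennreal ((d / 2)\<^sup>2) * indicator R x \<le> ennreal ((clip a b x - mean m (clip a b))\<^sup>2)"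
        using that(2)[of x] d power_mono[of "d / 2" "\<bar>clip a b x - mean m (clip a b)\<bar>" 2]
        by (cases "x \<in> R") (auto intro: ennreal_leI)
    qed
    finally show ?thesis .
  qed
  \<comment> \<open>If the mean lies in the upper half of the range, \<open>clip a b\<close> is far
    from it on \<open>P\<close>, otherwise on \<open>Q\<close>. In either case the mass of the other
    set is at most the total mass.\<close>
  have "ennreal ((d / 2)\<^sup>2) * (emeasure m P * emeasure m Q) \<le> emeasure m UNIV * V"
  proof (cases "mean m (clip a b) \<ge> (S a + S b) / 2")
    case True
    have "ennreal ((d / 2)\<^sup>2) * emeasure m P \<le> V"
    proof (rule far)
      fix x assume "x \<in> P"
      then have "clip a b x = S a"
        using P ab by (auto simp: clip_def)
      then show "d / 2 \<le> \<bar>clip a b x - mean m (clip a b)\<bar>"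
        using True unfolding d_def by argo
    qed (rule P)
    then have "ennreal ((d / 2)\<^sup>2) * emeasure m P * emeasure m Q \<le> V * emeasure m UNIV"
      by (intro mult_mono emeasure_m_le) auto
    then show ?thesis
      by (simp add: mult_ac)
  next
    case False
    have "ennreal ((d / 2)\<^sup>2) * emeasure m Q \<le> V"
    proof (rule far)
      fix x assume "x \<in> Q"
      then have "clip a b x = S b"
        using Q ab by (auto simp: clip_def)
      then show "d / 2 \<le> \<bar>clip a b x - mean m (clip a b)\<bar>"
        using False unfolding d_def by argo
    qed (rule Q)
    then have "ennreal ((d / 2)\<^sup>2) * emeasure m Q * emeasure m P \<le> V * emeasure m UNIV"
      by (intro mult_mono emeasure_m_le) auto
    then show ?thesis
      by (simp add: mult_ac)
  qed
  also have "\<dots> \<le> emeasure m UNIV * (c * ennreal d)"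
    using V by (rule mult_left_mono) simp
  \<comment> \<open>The 4 absorbs the square of \<open>1 / 2\<close>; afterwards one factor
    \<open>d\<close> cancels against the energy.\<close>
  finally have "4 * (ennreal ((d / 2)\<^sup>2) * (emeasure m P * emeasure m Q)) \<le> 4 * (emeasure m UNIV * (c * ennreal d))"
    by (rule mult_left_mono) simp
  moreover have "4 * ennreal ((d / 2)\<^sup>2) = ennreal d * ennreal d"
    using d ennreal_mult[of 4 "(d / 2)\<^sup>2"] ennreal_mult[of d d] by (simp add: power2_eq_square)
  then have "4 * (ennreal ((d / 2)\<^sup>2) * (emeasure m P * emeasure m Q))
      = ennreal d * (emeasure m P * (emeasure m Q * ennreal d))"
    by (metis mult.assoc mult.commute)
  moreover have "4 * (emeasure m UNIV * (c * ennreal d)) = ennreal d * (4 * emeasure m UNIV * c)"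
    by (simp add: mult_ac)
  ultimately have "ennreal d * (emeasure m P * (emeasure m Q * ennreal d)) \<le> ennreal d * (4 * emeasure m UNIV * c)"
    by simp
  then show ?thesis
    using d by (subst (asm) ennreal_mult_le_mult_iff) (auto simp: d_def)
qed simp

text \<open>Countably many such rays exhaust the line, so they cannot all be null. This supplies a
  base point with mass behind it.\<close>

lemma ex_emeasure_Iic_pos: "\<exists>b. 0 < emeasure m {..b}"
proof (rule ccontr)
  assume "\<not> ?thesis"
  then have "(\<Union>n::nat. {..real n}) \<in> null_sets m"
    by (intro null_sets_UN) (auto simp: null_sets_def sets_m)
  moreover have "(\<Union>n::nat. {..real n}) = UNIV"
    using real_arch_simple by blast
  ultimately show False
    using m_pos by (simp add: null_sets_def)
qed

lemma ex_emeasure_Ici_pos: "\<exists>b. 0 < emeasure m {b..}"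
proof (rule ccontr)
  assume "\<not> ?thesis"
  then have "(\<Union>n::nat. {- real n..}) \<in> null_sets m"
    by (intro null_sets_UN) (auto simp: null_sets_def sets_m)
  moreover have "(\<Union>n::nat. {- real n..}) = UNIV"
    using real_arch_simple[of "- x" for x] by (fastforce simp: minus_le_iff)
  ultimately show False
    using m_pos by (simp add: null_sets_def)
qed

lemma less_top_if_mult_le:
  fixes p B K :: ennreal
  assumes "p * B \<le> K" "K < \<infinity>" "0 < p"
  shows "B < \<infinity>"
  using assms by (metis ennreal_mult_eq_top_iff infinity_ennreal_def leD less_irrefl top.not_eq_extremum)

text \<open>The base point is first a \<open>b\<close> with positive mass behind it: that mass is a
  fixed factor in the tail bound, so the supremum over the moving ray is finite. Changing the base
  point then reaches every \<open>a\<close>.\<close>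

lemma poincare_imp_B_finite:
  assumes "poincare_const S m < \<infinity>"
  shows "B_plus S m a < \<infinity>" "B_minus S m a < \<infinity>"
proof -
  obtain c where c: "poincare_admissible c" "c < \<infinity>"
    using assms by (auto simp: poincare_const_eq Inf_less_iff)
  have K: "4 * emeasure m UNIV * c < \<infinity>"
    using c(2) m_finite by (simp add: ennreal_mult_less_top)
  obtain b where b: "0 < emeasure m {..b}"
    using ex_emeasure_Iic_pos by blast
  have "emeasure m {..b} * B_plus S m b \<le> 4 * emeasure m UNIV * c"
    unfolding B_plus_def SUP_mult_left_ennreal
    by (intro SUP_least poincare_tail_bound[OF c(1)]) auto
  then show "B_plus S m a < \<infinity>"
    using less_top_if_mult_le[OF _ K b] B_plus_finite_change_base by blast
  obtain b where b: "0 < emeasure m {b..}"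
    using ex_emeasure_Ici_pos by blast
  have "emeasure m {b..} * B_minus S m b \<le> 4 * emeasure m UNIV * c"
    unfolding B_minus_def SUP_mult_left_ennreal
  proof (intro SUP_least)
    fix x assume "x \<in> {..b}"
    \<comment> \<open>The moving ray now plays the part of \<open>P\<close>, and the fixed ray
      \<open>{b..}\<close> that of \<open>Q\<close>.\<close>
    then have "emeasure m {..<x} * (emeasure m {b..} * ennreal (S b - S x)) \<le> 4 * emeasure m UNIV * c"
      by (intro poincare_tail_bound[OF c(1)]) auto
    then show "emeasure m {b..} * (emeasure m {..<x} * ennreal (S b - S x)) \<le> 4 * emeasure m UNIV * c"
      by (simp add: mult_ac)
  qed
  then show "B_minus S m a < \<infinity>"
    using less_top_if_mult_le[OF _ K b] B_minus_finite_change_base by blast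
qed

section \<open>The two-sided estimate\<close>

text \<open>Arguing by contradiction avoids the question whether the infima are attained: half-line
  constants \<open>c1\<close> and \<open>c2\<close> strictly below the Poincare constant would make
  their maximum admissible on the whole line.\<close>

lemma poincare_le_max_A: "poincare_const S m \<le> max (A_plus S m a) (A_minus S m a)"
proof (rule ccontr)
  assume "\<not> ?thesis"
  then have less: "A_plus S m a < poincare_const S m" "A_minus S m a < poincare_const S m"
    by (simp_all add: not_le)
  obtain c1 where c1: "c1 < poincare_const S m" "\<And>F. F \<in> test_functions S m \<Longrightarrow>
      (\<integral>\<^sup>+x\<in>{a..}. ennreal ((F x - F a)\<^sup>2) \<partial>m) \<le> c1 * energy {a..} F"
    using less(1) unfolding A_plus_def Inf_less_iff by blast
  obtain c2 where c2: "c2 < poincare_const S m" "\<And>F. F \<in> test_functions S m \<Longrightarrow>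
      (\<integral>\<^sup>+x\<in>{..a}. ennreal ((F x - F a)\<^sup>2) \<partial>m) \<le> c2 * energy {..a} F"
    using less(2) unfolding A_minus_def Inf_less_iff by blast
  define c where "c = max c1 c2"
  have "poincare_admissible c"
    unfolding poincare_admissible_def
  proof
    fix F assume F: "F \<in> test_functions S m"
    have [measurable]: "F \<in> borel_measurable m"
      using test_function_L2(1)[OF F] by (rule L2_measurable)
    have "(\<integral>\<^sup>+x. ennreal ((F x - mean m F)\<^sup>2) \<partial>m) \<le> (\<integral>\<^sup>+x. ennreal ((F x - F a)\<^sup>2) \<partial>m)"
      by (rule variance_le[OF test_function_L2(1)[OF F]])
    also have "\<dots> = (\<integral>\<^sup>+x. ennreal ((F x - F a)\<^sup>2) * indicator {a..} x
        + ennreal ((F x - F a)\<^sup>2) * indicator {..a} x \<partial>m)"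
    proof (rule nn_integral_cong)
      fix x
      show "ennreal ((F x - F a)\<^sup>2) = ennreal ((F x - F a)\<^sup>2) * indicator {a..} x
          + ennreal ((F x - F a)\<^sup>2) * indicator {..a} x"
        by (cases "x = a") (auto split: split_indicator)
    qed
    also have "\<dots> = (\<integral>\<^sup>+x\<in>{a..}. ennreal ((F x - F a)\<^sup>2) \<partial>m)
        + (\<integral>\<^sup>+x\<in>{..a}. ennreal ((F x - F a)\<^sup>2) \<partial>m)"
      by (rule nn_integral_add) measurable
    also have "\<dots> \<le> c1 * energy {a..} F + c2 * energy {..a} F"
      by (intro add_mono c1 c2 F)
    also have "\<dots> \<le> c * energy {a..} F + c * energy {..a} F"
      by (intro add_mono mult_right_mono) (auto simp: c_def)
    also have "\<dots> = c * energy UNIV F"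
      by (simp only: energy_split[OF F, of a] distrib_left)
    finally show "(\<integral>\<^sup>+x. ennreal ((F x - mean m F)\<^sup>2) \<partial>m) \<le> c * energy UNIV F" .
  qed
  then have "poincare_const S m \<le> c"
    unfolding poincare_const_eq by (intro Inf_lower) simp
  then show False
    using c1 c2 by (auto simp: c_def max_def split: if_splits)
qed

text \<open>An admissible \<open>c\<close> below both half-line constants is refuted by one
  function, built from a violator \<open>F\<close> on the right of \<open>a\<close> and a violator
  \<open>G\<close> on the left.\<close>

lemma min_A_le_poincare: "min (A_plus S m a) (A_minus S m a) \<le> poincare_const S m"
proof (rule ccontr)
  assume "\<not> ?thesis"
  then obtain c where c: "poincare_admissible c" "c < A_plus S m a" "c < A_minus S m a"
    unfolding not_le poincare_const_eq Inf_less_iff by auto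
  obtain F where F: "F \<in> test_functions S m"
    and F_less: "c * energy {a..} F < (\<integral>\<^sup>+x\<in>{a..}. ennreal ((F x - F a)\<^sup>2) \<partial>m)"
  proof -
    have "c \<notin> {A. \<forall>F\<in>test_functions S m.
        (\<integral>\<^sup>+x\<in>{a..}. ennreal ((F x - F a)\<^sup>2) \<partial>m) \<le> A * energy {a..} F}"
      using c(2) unfolding A_plus_def by (rule not_in_if_less_Inf)
    then show ?thesis
      using that by (auto simp: not_le)
  qed
  obtain G where G: "G \<in> test_functions S m"
    and G_less: "c * energy {..a} G < (\<integral>\<^sup>+x\<in>{..a}. ennreal ((G x - G a)\<^sup>2) \<partial>m)"
  proof -
    have "c \<notin> {A. \<forall>F\<in>test_functions S m.
        (\<integral>\<^sup>+x\<in>{..a}. ennreal ((F x - F a)\<^sup>2) \<partial>m) \<le> A * energy {..a} F}"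
      using c(3) unfolding A_minus_def by (rule not_in_if_less_Inf)
    then show ?thesis
      using that by (auto simp: not_le)
  qed
  define f where "f x = F (max x a) - F a" for x
  define g where "g x = G (min x a) - G a" for x
  note FM = test_function_max[OF F, of a] and GM = test_function_min[OF G, of a]
  note [measurable] = F[THEN test_function_L2(1), THEN L2_measurable]
    G[THEN test_function_L2(1), THEN L2_measurable] F[THEN deriv_measurable] G[THEN deriv_measurable]
  have sq_f: "(\<integral>\<^sup>+x\<in>{a..}. ennreal ((F x - F a)\<^sup>2) \<partial>m) = (\<integral>\<^sup>+x. ennreal ((f x)\<^sup>2) \<partial>m)"
    and sq_g: "(\<integral>\<^sup>+x\<in>{..a}. ennreal ((G x - G a)\<^sup>2) \<partial>m) = (\<integral>\<^sup>+x. ennreal ((g x)\<^sup>2) \<partial>m)"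
    by (auto intro!: nn_integral_cong simp: f_def g_def max_def min_def split: split_indicator)
  have L2: "f \<in> L2 m" "g \<in> L2 m"
  proof -
    have const: "(\<lambda>_. 1) \<in> L2 m"
      by (simp add: L2_def)
    show "f \<in> L2 m"
      using L2_lin[OF test_function_L2(1)[OF FM(1)] const, of 1 "- F a"] by (simp add: f_def[abs_def])
    show "g \<in> L2 m"
      using L2_lin[OF test_function_L2(1)[OF GM(1)] const, of 1 "- G a"] by (simp add: g_def[abs_def])
  qed
  note [measurable] = L2[THEN L2_measurable]
  have fin: "(\<integral>\<^sup>+x. ennreal ((f x)\<^sup>2) \<partial>m) < \<infinity>" "(\<integral>\<^sup>+x. ennreal ((g x)\<^sup>2) \<partial>m) < \<infinity>"
    using L2[THEN L2_square_integrable] by (simp_all add: nn_integral_eq_integral)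
  \<comment> \<open>A nonzero vector orthogonal to the pair of integrals; if both vanish, any
    nonzero vector serves.\<close>
  obtain \<alpha> \<beta> :: real where \<alpha>\<beta>: "\<alpha> \<noteq> 0 \<or> \<beta> \<noteq> 0"
    and zero: "\<alpha> * (LINT x|m. f x) + \<beta> * (LINT x|m. g x) = 0"
  proof (cases "(LINT x|m. f x) = 0 \<and> (LINT x|m. g x) = 0")
    case True
    then show ?thesis
      using that[of 1 0] by simp
  next
    case False
    then show ?thesis
      using that[of "LINT x|m. g x" "- (LINT x|m. f x)"] by auto
  qed
  \<comment> \<open>\<open>H\<close> is \<open>\<alpha> * f x + \<beta> * g x\<close> plus a
    constant. By the choice of the weights its mean is this constant, which is also its value at
    \<open>a\<close>.\<close>
  define H where "H x = \<alpha> * F (max x a) + \<beta> * G (min x a)" for x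
  have H: "H \<in> test_functions S m"
    and H_deriv: "AE x in dS. deriv_wrt S H x
      = \<alpha> * deriv_wrt S (\<lambda>x. F (max x a)) x + \<beta> * deriv_wrt S (\<lambda>x. G (min x a)) x"
    using test_function_lin[OF FM(1) GM(1), of \<alpha> \<beta>] by (simp_all add: H_def[abs_def])
  have H_eq: "H x = \<alpha> * f x + \<beta> * g x + (\<alpha> * F a + \<beta> * G a)" for x
    by (simp add: H_def f_def g_def algebra_simps)
  have "(LINT x|m. H x) = \<alpha> * (LINT x|m. f x) + \<beta> * (LINT x|m. g x) + (\<alpha> * F a + \<beta> * G a) * measure m UNIV"
    unfolding H_eq using L2[THEN L2_integrable] by (simp add: space_m)
  then have mean: "mean m H = \<alpha> * F a + \<beta> * G a"
    using zero measure_m_pos by (simp add: mean_def)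
  have "(\<integral>\<^sup>+x. ennreal ((H x - mean m H)\<^sup>2) \<partial>m)
      = (\<integral>\<^sup>+x. ennreal (\<alpha>\<^sup>2) * ennreal ((f x)\<^sup>2) + ennreal (\<beta>\<^sup>2) * ennreal ((g x)\<^sup>2) \<partial>m)"
  proof (rule nn_integral_cong)
    fix x
    \<comment> \<open>\<open>f\<close> vanishes up to \<open>a\<close> and \<open>g\<close> from
      \<open>a\<close> on, so the square has no mixed term.\<close>
    have "f x = 0 \<or> g x = 0"
      by (simp add: f_def g_def max_def min_def)
    then show "ennreal ((H x - mean m H)\<^sup>2)
        = ennreal (\<alpha>\<^sup>2) * ennreal ((f x)\<^sup>2) + ennreal (\<beta>\<^sup>2) * ennreal ((g x)\<^sup>2)"
      by (auto simp: mean H_eq power_mult_distrib ennreal_mult)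
  qed
  also have "\<dots> = ennreal (\<alpha>\<^sup>2) * (\<integral>\<^sup>+x. ennreal ((f x)\<^sup>2) \<partial>m) + ennreal (\<beta>\<^sup>2) * (\<integral>\<^sup>+x. ennreal ((g x)\<^sup>2) \<partial>m)"
    by (simp add: nn_integral_add nn_integral_cmult)
  finally have V: "(\<integral>\<^sup>+x. ennreal ((H x - mean m H)\<^sup>2) \<partial>m) = \<dots>" .
  \<comment> \<open>The mixed term of the energy lives only at the null point
    \<open>a\<close>.\<close>
  have "energy UNIV H = (\<integral>\<^sup>+x. ennreal (\<alpha>\<^sup>2) * (ennreal ((deriv_wrt S F x)\<^sup>2) * indicator {a..} x)
      + ennreal (\<beta>\<^sup>2) * (ennreal ((deriv_wrt S G x)\<^sup>2) * indicator {..a} x) \<partial>dS)"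
  proof (rule nn_integral_cong_AE)
    show "AE x in dS. ennreal ((deriv_wrt S H x)\<^sup>2) * indicator UNIV x
      = ennreal (\<alpha>\<^sup>2) * (ennreal ((deriv_wrt S F x)\<^sup>2) * indicator {a..} x)
      + ennreal (\<beta>\<^sup>2) * (ennreal ((deriv_wrt S G x)\<^sup>2) * indicator {..a} x)"
      using H_deriv FM(2) GM(2) AE_dS_neq[of a]
      by eventually_elim (auto simp: power_mult_distrib ennreal_mult split: split_indicator)
  qed
  also have "\<dots> = ennreal (\<alpha>\<^sup>2) * energy {a..} F + ennreal (\<beta>\<^sup>2) * energy {..a} G"
    by (simp add: nn_integral_add nn_integral_cmult)
  finally have E: "energy UNIV H = \<dots>" .
  \<comment> \<open>The two violations are added with weights of which at least one is positive;
    \<open>fin\<close> keeps the inequality strict.\<close>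
  have "ennreal (\<alpha>\<^sup>2) * (c * energy {a..} F) + ennreal (\<beta>\<^sup>2) * (c * energy {..a} G)
      < ennreal (\<alpha>\<^sup>2) * (\<integral>\<^sup>+x. ennreal ((f x)\<^sup>2) \<partial>m) + ennreal (\<beta>\<^sup>2) * (\<integral>\<^sup>+x. ennreal ((g x)\<^sup>2) \<partial>m)"
    using F_less G_less fin \<alpha>\<beta> unfolding sq_f sq_g
    by (intro add_mult_strict_mono_ennreal) auto
  also have "\<dots> \<le> c * energy UNIV H"
    using c(1) H unfolding V[symmetric] poincare_admissible_def by blast
  also have "\<dots> = ennreal (\<alpha>\<^sup>2) * (c * energy {a..} F) + ennreal (\<beta>\<^sup>2) * (c * energy {..a} G)"
    unfolding E by (simp add: distrib_left mult.left_commute)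
  finally show False
    by simp
qed

end

theorem theorem2p2:
  fixes S :: "real \<Rightarrow> real" and m :: "real measure"
  assumes "strict_mono S"
    and "continuous_on UNIV S"
    and "filterlim S at_top at_top"
    and "filterlim S at_bot at_bot"
    and "sets m = sets borel"
    and "0 < emeasure m UNIV"
    and "emeasure m UNIV < \<infinity>"
  shows "(SUP a. min (A_plus S m a) (A_minus S m a)) \<le> poincare_const S m
    \<and> poincare_const S m \<le> (INF a. max (A_plus S m a) (A_minus S m a))
    \<and> (poincare_const S m < \<infinity> \<longleftrightarrow> (\<exists>a. A_plus S m a < \<infinity> \<and> A_minus S m a < \<infinity>))
    \<and> (poincare_const S m < \<infinity> \<longleftrightarrow> (\<exists>a. B_plus S m a < \<infinity> \<and> B_minus S m a < \<infinity>))
    \<and> (\<forall>a. A_plus S m a < \<infinity> \<and> A_minus S m a < \<infinity> \<longleftrightarrow> B_plus S m a < \<infinity> \<and> B_minus S m a < \<infinity>)"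
proof -
  interpret scale_and_speed S m
    using assms by unfold_locales auto
  \<comment> \<open>A finite Poincare constant makes \<open>B\<close> finite at every base point, so
    any witness will do; conversely the upper bound at the given \<open>a\<close> is enough.\<close>
  have finite_iff: "poincare_const S m < \<infinity> \<longleftrightarrow> (\<exists>a. B_plus S m a < \<infinity> \<and> B_minus S m a < \<infinity>)"
  proof
    assume "\<exists>a. B_plus S m a < \<infinity> \<and> B_minus S m a < \<infinity>"
    then obtain a where "A_plus S m a < \<infinity>" "A_minus S m a < \<infinity>"
      using A_plus_finite_iff A_minus_finite_iff by blast
    then show "poincare_const S m < \<infinity>"
      using poincare_le_max_A[of a] by (auto simp: max_def split: if_splits)
  qed (use poincare_imp_B_finite in blast)
  show ?thesis
    using min_A_le_poincare poincare_le_max_A finite_iff A_plus_finite_iff A_minus_finite_iff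
    by (simp add: SUP_le_iff le_INF_iff)
qed

end
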